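(* For every nonnegative integer $n$, the maps $Q_{inn}:(\mathfrak{I}^{*}_n, \|\cdot\|_{\infty})\rightarrow (\mathfrak{I}, \|\cdot\|_{2})$ and $Q_{out}:(\mathfrak{I}^{*}_n, \|\cdot\|_{\infty})\rightarrow (\mathfrak{F}, \|\cdot\|_{2})$ are continuous; that is, both are continuous when the domain $\mathfrak{I}^{*}_n$ carries the metric induced by the supremum norm and the target carries the metric induced by the $H^2$-norm.
   Context: $\mathbb{D}$ is the open unit disc, $\mathbb{T}$ the unit circle, $H^{\infty}$ the Banach algebra of bounded analytic functions on $\mathbb{D}$ with the supremum norm $\|f\|_{\infty}=\sup_{z\in\mathbb{D}}|f(z)|$, and $(H^{\infty})^{-1}$ the set of invertible elements of $H^{\infty}$. $H^2$ is the classical Hardy space on $\mathbb{D}$ with norm $\|\cdot\|_2$. An inner function is a bounded analytic function on $\mathbb{D}$ with unimodular radial limits almost everywhere on $\mathbb{T}$; $\mathfrak{I}$ is the set of all inner functions. An outer function is a bounded analytic function $F$ on $\mathbb{D}$ that is a cyclic vector for the multiplication operator $M_z$ on $H^2$, i.e. the closed linear span of $\{z^kF(z): k\ge 0\}$ is $H^2$; $\mathfrak{F}$ is the set of all outer functions. An inner function $u$ is called normalized if $u^{(n_0)}(0)>0$, where $n_0$ is the smallest nonnegative integer with $u^{(n_0)}(0)\neq 0$. Every nonzero $f\in H^{\infty}$ has a unique factorization $f=uF$ with $u$ a normalized inner function and $F$ an outer function; put $Q_{inn}(f)=u$ and $Q_{out}(f)=F$. $\mathfrak{I}^{*}$ is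 the set of functions in $H^{\infty}$ of the form $f=uh$ with $u$ an inner function and $h\in (H^{\infty})^{-1}$. For nonzero $f\in H^{\infty}$, $\mathrm{Mul}_0(f)=\inf\{k\ge 0: f^{(k)}(0)\neq 0\}$ is the multiplicity of the zero of $f$ at $0$, and for $n=0,1,2,\ldots$, $\mathfrak{I}^{*}_n=\{f\in\mathfrak{I}^{*}: \mathrm{Mul}_0(f)=n\}$. *)

theory Defs
  imports "HOL-Complex_Analysis.Complex_Analysis"
begin

abbreviation disc :: "complex set" where
  "disc \<equiv> ball 0 1"

(* A function on the disc is represented by its extension by 0 to the whole type, so that
   functions agreeing on the disc are equal. This is needed for the sup norm and the H^2-norm
   to be norms, and for factorizations to be unique. The extension by 0 (rather than by
   undefined) keeps the spaces closed under pointwise sums and products. *)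
definition hol_disc :: "(complex \<Rightarrow> complex) set" where
  "hol_disc = {f. f holomorphic_on disc \<and> (\<forall>z. z \<notin> disc \<longrightarrow> f z = 0)}"

definition Hinf :: "(complex \<Rightarrow> complex) set" where
  "Hinf = {f \<in> hol_disc. bounded (f ` disc)}"

definition sup_norm :: "(complex \<Rightarrow> complex) \<Rightarrow> real" where
  "sup_norm f = (SUP z\<in>disc. norm (f z))"

definition Hinf_inv :: "(complex \<Rightarrow> complex) set" where
  "Hinf_inv = {h \<in> Hinf. \<exists>g\<in>Hinf. \<forall>z\<in>disc. h z * g z = 1}"

definition circle_mean :: "(complex \<Rightarrow> complex) \<Rightarrow> real \<Rightarrow> real" where
  "circle_mean f r = integral {0..2 * pi} (\<lambda>t. (norm (f (of_real r * cis t)))\<^sup>2) / (2 * pi)"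

definition H2 :: "(complex \<Rightarrow> complex) set" where
  "H2 = {f \<in> hol_disc. bdd_above (circle_mean f ` {0..<1})}"

definition H2_norm :: "(complex \<Rightarrow> complex) \<Rightarrow> real" where
  "H2_norm f = sqrt (SUP r\<in>{0..<1}. circle_mean f r)"

(* The value 0 outside the space is forced by the locale Metric_space, which asks for
   nonnegativity of the distance on the whole type (a supremum of an unbounded set of reals
   is an unspecified real). *)
definition sup_dist :: "(complex \<Rightarrow> complex) \<Rightarrow> (complex \<Rightarrow> complex) \<Rightarrow> real" where
  "sup_dist f g = (if f \<in> Hinf \<and> g \<in> Hinf then sup_norm (\<lambda>z. f z - g z) else 0)"

definition H2_dist :: "(complex \<Rightarrow> complex) \<Rightarrow> (complex \<Rightarrow> complex) \<Rightarrow> real" where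
  "H2_dist f g = (if f \<in> H2 \<and> g \<in> H2 then H2_norm (\<lambda>z. f z - g z) else 0)"

abbreviation sup_top :: "(complex \<Rightarrow> complex) set \<Rightarrow> (complex \<Rightarrow> complex) topology" where
  "sup_top M \<equiv> Metric_space.mtopology M sup_dist"

abbreviation H2_top :: "(complex \<Rightarrow> complex) set \<Rightarrow> (complex \<Rightarrow> complex) topology" where
  "H2_top M \<equiv> Metric_space.mtopology M H2_dist"

definition inner_funs :: "(complex \<Rightarrow> complex) set" where
  "inner_funs = {u \<in> Hinf. AE t in lebesgue_on {0..2 * pi}.
     \<exists>w. ((\<lambda>r. u (of_real r * cis t)) \<longlongrightarrow> w) (at_left 1) \<and> norm w = 1}"

definition shift_span :: "(complex \<Rightarrow> complex) \<Rightarrow> (complex \<Rightarrow> complex) set" where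
  "shift_span F = {(\<lambda>z. \<Sum>k<N. c k * (z ^ k * F z)) | (N::nat) (c::nat \<Rightarrow> complex). True}"

definition outer_funs :: "(complex \<Rightarrow> complex) set" where
  "outer_funs = {F \<in> Hinf. H2_top H2 closure_of shift_span F = H2}"

definition mul0 :: "(complex \<Rightarrow> complex) \<Rightarrow> nat" where
  "mul0 f = (LEAST k. (deriv ^^ k) f 0 \<noteq> 0)"

definition normalized_inner :: "(complex \<Rightarrow> complex) \<Rightarrow> bool" where
  "normalized_inner u \<longleftrightarrow> u \<in> inner_funs \<and>
     (\<exists>c::real. c > 0 \<and> (deriv ^^ mul0 u) u 0 = of_real c)"

definition inn_out_pair :: "(complex \<Rightarrow> complex) \<Rightarrow> (complex \<Rightarrow> complex) \<times> (complex \<Rightarrow> complex)" where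
  "inn_out_pair f = (THE (u, F). normalized_inner u \<and> F \<in> outer_funs \<and> f = (\<lambda>z. u z * F z))"

definition Q_inn :: "(complex \<Rightarrow> complex) \<Rightarrow> complex \<Rightarrow> complex" where
  "Q_inn f = fst (inn_out_pair f)"

definition Q_out :: "(complex \<Rightarrow> complex) \<Rightarrow> complex \<Rightarrow> complex" where
  "Q_out f = snd (inn_out_pair f)"

definition Istar :: "(complex \<Rightarrow> complex) set" where
  "Istar = {(\<lambda>z. u z * h z) | u h. u \<in> inner_funs \<and> h \<in> Hinf_inv}"

definition Istar_n :: "nat \<Rightarrow> (complex \<Rightarrow> complex) set" where
  "Istar_n n = {f \<in> Istar. mul0 f = n}"

section \<open>The distances are metrics\<close>

lemma hol_disc_diff: "f \<in> hol_disc \<Longrightarrow> g \<in> hol_disc \<Longrightarrow> (\<lambda>z. f z - g z) \<in> hol_disc"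
  by (auto simp: hol_disc_def intro!: holomorphic_intros)

lemma hol_disc_eqI:
  assumes "f \<in> hol_disc" "g \<in> hol_disc" "\<And>z. z \<in> disc \<Longrightarrow> f z = g z"
  shows "f = g"
  using assms by (auto simp: hol_disc_def fun_eq_iff) metis

lemma Hinf_diff:
  assumes "f \<in> Hinf" "g \<in> Hinf"
  shows "(\<lambda>z. f z - g z) \<in> Hinf"
  using assms by (auto simp: Hinf_def intro: hol_disc_diff bounded_minus_comp)

lemma Hinf_bdd: "f \<in> Hinf \<Longrightarrow> bdd_above ((\<lambda>z. norm (f z)) ` disc)"
  by (auto simp: Hinf_def bounded_iff bdd_above_def)

lemma sup_norm_ge: "f \<in> Hinf \<Longrightarrow> z \<in> disc \<Longrightarrow> norm (f z) \<le> sup_norm f"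
  unfolding sup_norm_def by (rule cSUP_upper[OF _ Hinf_bdd])

lemma sup_norm_le: "(\<And>z. z \<in> disc \<Longrightarrow> norm (f z) \<le> B) \<Longrightarrow> sup_norm f \<le> B"
  unfolding sup_norm_def by (rule cSUP_least) auto

lemma sup_norm_nonneg: "f \<in> Hinf \<Longrightarrow> 0 \<le> sup_norm f"
  by (rule order_trans[OF norm_ge_zero sup_norm_ge[of f 0]]) auto

lemma Metric_space_sup_dist: "Metric_space Hinf sup_dist"
proof
  fix f g :: "complex \<Rightarrow> complex"
  show "0 \<le> sup_dist f g"
    by (simp add: sup_dist_def sup_norm_nonneg Hinf_diff)
  show "sup_dist f g = sup_dist g f"
    by (simp add: sup_dist_def sup_norm_def norm_minus_commute)
next
  fix f g assume fg: "f \<in> Hinf" "g \<in> Hinf"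
  show "sup_dist f g = 0 \<longleftrightarrow> f = g"
  proof
    assume "sup_dist f g = 0"
    then have "f z = g z" if "z \<in> disc" for z
      using sup_norm_ge[OF Hinf_diff[OF fg] that] fg by (simp add: sup_dist_def)
    then show "f = g"
      using fg by (intro hol_disc_eqI) (auto simp: Hinf_def)
  qed (auto simp: sup_dist_def sup_norm_def)
next
  fix f g h assume fgh: "f \<in> Hinf" "g \<in> Hinf" "h \<in> Hinf"
  have "sup_norm (\<lambda>z. f z - h z) \<le> sup_norm (\<lambda>z. f z - g z) + sup_norm (\<lambda>z. g z - h z)"
  proof (rule sup_norm_le)
    fix z assume z: "z \<in> disc"
    have "norm (f z - h z) \<le> norm (f z - g z) + norm (g z - h z)"
      using norm_triangle_ineq[of "f z - g z" "g z - h z"] by simp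
    then show "norm (f z - h z) \<le> sup_norm (\<lambda>z. f z - g z) + sup_norm (\<lambda>z. g z - h z)"
      using sup_norm_ge[OF Hinf_diff[OF fgh(1,2)] z] sup_norm_ge[OF Hinf_diff[OF fgh(2,3)] z]
      by simp
  qed
  then show "sup_dist f h \<le> sup_dist f g + sup_dist g h"
    using fgh by (simp add: sup_dist_def)
qed

lemma continuous_circle:
  assumes "f \<in> hol_disc" "r \<in> {0..<1}"
  shows "continuous_on A (\<lambda>t. (norm (f (of_real r * cis t)))\<^sup>2)"
proof -
  have "continuous_on disc f"
    using assms(1) by (simp add: hol_disc_def holomorphic_on_imp_continuous_on)
  then have "continuous_on A (\<lambda>t. f (of_real r * cis t))"
    by (rule continuous_on_compose2)
      (use assms(2) in \<open>auto intro!: continuous_intros simp: norm_mult\<close>)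
  then show ?thesis by (intro continuous_intros)
qed

lemma integrable_circle:
  assumes "f \<in> hol_disc" "r \<in> {0..<1}"
  shows "(\<lambda>t. (norm (f (of_real r * cis t)))\<^sup>2) integrable_on {0..2 * pi}"
  by (rule integrable_continuous_interval[OF continuous_circle[OF assms]])

lemma circle_mean_nonneg: "0 \<le> circle_mean f r"
proof (cases "(\<lambda>t. (norm (f (of_real r * cis t)))\<^sup>2) integrable_on {0..2 * pi}")
  case True
  then show ?thesis by (simp add: circle_mean_def integral_nonneg)
next
  case False
  then show ?thesis by (simp add: circle_mean_def not_integrable_integral)
qed

lemma circle_mean_le:
  assumes fg: "f \<in> hol_disc" "g \<in> hol_disc" "h \<in> hol_disc" and r: "r \<in> {0..<1}"
    and le: "\<And>z. z \<in> disc \<Longrightarrow> (norm (h z))\<^sup>2 \<le> p * (norm (f z))\<^sup>2 + q * (norm (g z))\<^sup>2"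
  shows "circle_mean h r \<le> p * circle_mean f r + q * circle_mean g r"
proof -
  note [simp] = integrable_circle[OF fg(1) r] integrable_circle[OF fg(2) r]
    integrable_circle[OF fg(3) r]
  have "integral {0..2*pi} (\<lambda>t. (norm (h (of_real r * cis t)))\<^sup>2)
    \<le> integral {0..2*pi} (\<lambda>t. p * (norm (f (of_real r * cis t)))\<^sup>2 + q * (norm (g (of_real r * cis t)))\<^sup>2)"
    using r by (intro integral_le integrable_add integrable_on_mult_right le)
      (auto simp: norm_mult)
  also have "\<dots> = p * integral {0..2*pi} (\<lambda>t. (norm (f (of_real r * cis t)))\<^sup>2)
      + q * integral {0..2*pi} (\<lambda>t. (norm (g (of_real r * cis t)))\<^sup>2)"
    by (subst integral_add) (auto intro!: integrable_on_mult_right)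
  finally show ?thesis
    by (simp add: circle_mean_def field_simps)
qed

lemma circle_mean_le_H2_norm:
  assumes "f \<in> H2" "r \<in> {0..<1}"
  shows "circle_mean f r \<le> (H2_norm f)\<^sup>2"
proof -
  have "circle_mean f r \<le> (SUP r\<in>{0..<1}. circle_mean f r)"
    using assms by (intro cSUP_upper) (auto simp: H2_def)
  moreover have "0 \<le> circle_mean f r" by (rule circle_mean_nonneg)
  ultimately show ?thesis by (simp add: H2_norm_def)
qed

lemma H2_norm_nonneg: "f \<in> H2 \<Longrightarrow> 0 \<le> H2_norm f"
  unfolding H2_norm_def real_sqrt_ge_0_iff
  by (rule cSUP_upper2[of _ _ 0]) (auto simp: H2_def circle_mean_nonneg)

lemma H2_norm_le:
  assumes "0 \<le> B" "\<And>r. r \<in> {0..<1} \<Longrightarrow> circle_mean f r \<le> B\<^sup>2"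
  shows "H2_norm f \<le> B"
  unfolding H2_norm_def
  by (rule real_le_lsqrt[OF _ cSUP_least]) (use assms in auto)

lemma H2_diff:
  assumes "f \<in> H2" "g \<in> H2"
  shows "(\<lambda>z. f z - g z) \<in> H2"
proof -
  have hol: "f \<in> hol_disc" "g \<in> hol_disc" "(\<lambda>z. f z - g z) \<in> hol_disc"
    using assms by (auto simp: H2_def hol_disc_diff)
  have "(norm (f z - g z))\<^sup>2 \<le> 2 * (norm (f z))\<^sup>2 + 2 * (norm (g z))\<^sup>2" for z
    using power_mono[OF norm_triangle_ineq4[of "f z" "g z"], of 2]
      sum_squares_bound[of "norm (f z)" "norm (g z)"]
    by (simp add: power2_sum)
  then have "circle_mean (\<lambda>z. f z - g z) r \<le> 2 * (H2_norm f)\<^sup>2 + 2 * (H2_norm g)\<^sup>2"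
    if "r \<in> {0..<1}" for r
    using circle_mean_le[OF hol that, of 2 2] circle_mean_le_H2_norm[OF assms(1) that]
      circle_mean_le_H2_norm[OF assms(2) that] by force
  then show ?thesis using hol(3) by (force simp: H2_def intro: bdd_aboveI2)
qed

lemma H2_norm_eq_0:
  assumes "f \<in> H2" "H2_norm f = 0" "z \<in> disc"
  shows "f z = 0"
proof -
  define r where "r = norm z"
  have r: "r \<in> {0..<1}" using assms(3) by (simp add: r_def)
  have hol: "f \<in> hol_disc" using assms(1) by (simp add: H2_def)
  have "circle_mean f r = 0"
    using circle_mean_le_H2_norm[OF assms(1) r] assms(2) circle_mean_nonneg[of f r] by simp
  then have "integral {0..2*pi} (\<lambda>t. (norm (f (of_real r * cis t)))\<^sup>2) = 0"
    by (simp add: circle_mean_def)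
  then have *: "(norm (f (of_real r * cis t)))\<^sup>2 = 0" if "t \<in> {0..2*pi}" for t
    using integral_eq_0_iff[OF continuous_circle[OF hol r], of 0 "2*pi"] that by auto
  have "z = of_real r * cis (Arg2pi z)"
    using complex_norm_eq_1_exp Arg2pi_eq[of z] by (simp add: r_def cis_conv_exp)
  then show ?thesis
    using *[of "Arg2pi z"] Arg2pi[of z] by (simp add: less_imp_le)
qed

lemma H2_norm_triangle:
  assumes f: "f \<in> H2" and g: "g \<in> H2" and h: "h \<in> hol_disc"
    and eq: "\<And>z. z \<in> disc \<Longrightarrow> h z = f z + g z"
  shows "H2_norm h \<le> H2_norm f + H2_norm g"
proof (rule field_le_epsilon)
  fix e :: real assume e: "e > 0"
  define a b where "a = H2_norm f + e / 2" and "b = H2_norm g + e / 2"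
  have a: "a > 0" "H2_norm f \<le> a" and b: "b > 0" "H2_norm g \<le> b"
    using e H2_norm_nonneg[OF f] H2_norm_nonneg[OF g] by (auto simp: a_def b_def)
  have hol: "f \<in> hol_disc" "g \<in> hol_disc" using f g by (auto simp: H2_def)
  have "H2_norm h \<le> a + b"
  proof (rule H2_norm_le)
    fix r :: real assume r: "r \<in> {0..<1}"
    have "circle_mean h r \<le> (a + b) / a * circle_mean f r + (a + b) / b * circle_mean g r"
    proof (rule circle_mean_le[OF hol h r])
      fix z assume "z \<in> disc"
      define x y where "x = norm (f z)" and "y = norm (g z)"
      have "(norm (h z))\<^sup>2 \<le> (x + y)\<^sup>2"
        using norm_triangle_ineq[of "f z" "g z"] eq[OF \<open>z \<in> disc\<close>]
        by (simp add: x_def y_def power_mono)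
      also have "(a + b) / a * x\<^sup>2 + (a + b) / b * y\<^sup>2 - (x + y)\<^sup>2 = (b * x - a * y)\<^sup>2 / (a * b)"
        using a(1) b(1) by (simp add: field_simps power2_eq_square)
      then have "(x + y)\<^sup>2 \<le> (a + b) / a * x\<^sup>2 + (a + b) / b * y\<^sup>2"
        using a(1) b(1) by (smt (verit) divide_nonneg_pos mult_pos_pos zero_le_power2)
      finally show "(norm (h z))\<^sup>2 \<le> (a + b) / a * (norm (f z))\<^sup>2 + (a + b) / b * (norm (g z))\<^sup>2"
        by (simp add: x_def y_def)
    qed
    also have "\<dots> \<le> (a + b) / a * a\<^sup>2 + (a + b) / b * b\<^sup>2"
    proof (intro add_mono mult_left_mono)
      show "circle_mean f r \<le> a\<^sup>2"
        using circle_mean_le_H2_norm[OF f r] power_mono[OF a(2) H2_norm_nonneg[OF f], of 2] by simp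
      show "circle_mean g r \<le> b\<^sup>2"
        using circle_mean_le_H2_norm[OF g r] power_mono[OF b(2) H2_norm_nonneg[OF g], of 2] by simp
    qed (use a(1) b(1) in auto)
    also have "\<dots> = (a + b)\<^sup>2"
      using a(1) b(1) by (simp add: field_simps power2_eq_square)
    finally show "circle_mean h r \<le> (a + b)\<^sup>2" .
  qed (use a b in simp)
  then show "H2_norm h \<le> H2_norm f + H2_norm g + e" by (simp add: a_def b_def)
qed

lemma Metric_space_H2_dist: "Metric_space H2 H2_dist"
proof
  fix f g :: "complex \<Rightarrow> complex"
  show "0 \<le> H2_dist f g"
    by (simp add: H2_dist_def H2_norm_nonneg H2_diff)
  show "H2_dist f g = H2_dist g f"
    by (simp add: H2_dist_def H2_norm_def circle_mean_def norm_minus_commute)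
next
  fix f g assume fg: "f \<in> H2" "g \<in> H2"
  show "H2_dist f g = 0 \<longleftrightarrow> f = g"
  proof
    assume "H2_dist f g = 0"
    then have "f z = g z" if "z \<in> disc" for z
      using H2_norm_eq_0[OF H2_diff[OF fg] _ that] fg by (simp add: H2_dist_def)
    then show "f = g"
      using fg by (intro hol_disc_eqI) (auto simp: H2_def)
  qed (auto simp: H2_dist_def H2_norm_def circle_mean_def)
next
  fix f g h assume fgh: "f \<in> H2" "g \<in> H2" "h \<in> H2"
  have "(\<lambda>z. f z - h z) \<in> hol_disc" using fgh by (auto simp: H2_def hol_disc_diff)
  then show "H2_dist f h \<le> H2_dist f g + H2_dist g h"
    using fgh H2_norm_triangle[OF H2_diff[OF fgh(1,2)] H2_diff[OF fgh(2,3)]]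
    by (simp add: H2_dist_def)
qed

lemma Hinf_subset_H2: "Hinf \<subseteq> H2"
proof
  fix f assume f: "f \<in> Hinf"
  then have hol: "f \<in> hol_disc" by (simp add: Hinf_def)
  have "circle_mean f r \<le> (sup_norm f)\<^sup>2" if r: "r \<in> {0..<1}" for r
  proof -
    have "integral {0..2*pi} (\<lambda>t. (norm (f (of_real r * cis t)))\<^sup>2)
      \<le> integral {0..2*pi} (\<lambda>t. (sup_norm f)\<^sup>2)"
      using r by (intro integral_le integrable_circle[OF hol r] power_mono sup_norm_ge[OF f])
        (auto simp: norm_mult)
    then show ?thesis by (simp add: circle_mean_def field_simps)
  qed
  then show "f \<in> H2" using hol by (force simp: H2_def intro: bdd_aboveI2)
qed

end

theory Submission
  imports Defs
begin

text \<open>Let \<open>f = u F\<close> and \<open>g = v G\<close> be two functions in \<open>Istar_n n\<close>, split into their inner and outer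
factors. The outer factor \<open>F\<close> is invertible, so \<open>\<bar>F\<bar> \<ge> \<delta> > 0\<close> on the disc, and if \<open>g\<close> is within \<open>\<eta> \<delta>\<close>
of \<open>f\<close> in the sup norm, the quotient \<open>K = G / F\<close> satisfies \<open>\<bar>v K - u\<bar> \<le> \<eta>\<close>. Inner functions have
modulus tending to \<open>1\<close> along almost every radius, so \<open>\<bar>K\<bar>\<close> is asymptotically between \<open>1 - \<eta>\<close> and
\<open>1 + \<eta>\<close> there. This bounds the Hardy norm of \<open>K\<close> by \<open>1 + \<eta>\<close> and, applied to \<open>1 / K\<close>, bounds
\<open>\<bar>K(0)\<bar>\<close> below by \<open>1 - \<eta>\<close>; as the squared Hardy norm is the sum of the squared moduli of the Taylor
coefficients, \<open>K\<close> differs from the constant \<open>b = K(0)\<close> by at most \<open>2 \<surd>\<eta>\<close> (\<open>outer_ratio_estimate\<close>).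
Consequently \<open>b v\<close> is close to \<open>u\<close>. Both functions have a zero of order exactly \<open>n\<close> at the origin
and positive \<open>n\<close>-th coefficient, which forces \<open>b\<close> to be close to \<open>1\<close> (\<open>phase_estimate\<close>), and then
\<open>v\<close> is close to \<open>u\<close> and \<open>G\<close> to \<open>F\<close> (\<open>factor_estimate\<close>). The fixed order of the zero is essential:
otherwise the positive coefficients that determine the phase would not be comparable.

The tool behind every norm bound is that Hardy norms of bounded functions can be compared
along almost every radius (\<open>H2_norm_le_if_radially_le\<close>). It follows from dominated convergence and the
monotonicity of circle means, so that neither boundary functions nor Poisson integrals of
logarithms occur.

The factorization of a function in \<open>Istar\<close> must also be identified with the one selected by
\<open>inn_out_pair\<close>, for which the competing outer factor is known only to be cyclic. Two such
factorizations differ by a cyclic function with unimodular radial limits, and such a function is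
constant (\<open>unimodular_cyclic_imp_const\<close>, \<open>inner_outer_unique\<close>).\<close>

section \<open>Taylor coefficients and the Hardy norm\<close>

definition coef :: "(complex \<Rightarrow> complex) \<Rightarrow> nat \<Rightarrow> complex" where
  "coef f n = (deriv ^^ n) f 0 / fact n"

lemma coef_sums:
  assumes "f \<in> hol_disc" "z \<in> disc"
  shows "(\<lambda>n. coef f n * z ^ n) sums f z"
  using holomorphic_power_series[of f 0 1 z] assms by (simp add: hol_disc_def coef_def)

lemma coef_0 [simp]: "coef f 0 = f 0"
  by (simp add: coef_def)

lemma coef_diff:
  assumes "f \<in> hol_disc" "g \<in> hol_disc"
  shows "coef (\<lambda>z. f z - g z) n = coef f n - coef g n"
  using higher_deriv_diff[of f disc g 0 n] assms
  by (simp add: hol_disc_def coef_def diff_divide_distrib)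

lemma coef_cmult:
  assumes "f \<in> hol_disc"
  shows "coef (\<lambda>z. c * f z) n = c * coef f n"
  using higher_deriv_cmult[of f disc 0 n c] assms by (simp add: hol_disc_def coef_def)

lemma integral_cis:
  "((\<lambda>t. cis (real_of_int k * t)) has_integral (if k = 0 then of_real (2 * pi) else 0)) {0..2 * pi}"
proof (cases "k = 0")
  case True
  then show ?thesis
    using has_integral_const_real[of "1::complex" 0 "2 * pi"]
    by (simp add: scaleR_conv_of_real)
next
  case False
  define F where "F t = cis (real_of_int k * t) / (\<i> * of_int k)" for t
  have "((\<lambda>t. cis (real_of_int k * t)) has_integral (F (2 * pi) - F 0)) {0..2 * pi}"
  proof (rule fundamental_theorem_of_calculus)
    show "(F has_vector_derivative cis (real_of_int k * t)) (at t within {0..2 * pi})"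
      if "t \<in> {0..2 * pi}" for t
      unfolding F_def cis_conv_exp of_real_mult
      by (rule has_vector_derivative_real_field)
        (use False in \<open>auto intro!: derivative_eq_intros simp: field_simps\<close>)
  qed simp
  moreover have "cis (real_of_int k * (2 * pi)) = 1"
    using cis_multiple_2pi[of "real_of_int k"] by (simp add: mult.commute)
  ultimately show ?thesis using False by (simp add: F_def)
qed

text \<open>Expand the square into a double sum; only the diagonal survives integration.\<close>

lemma integral_norm_trig_poly:
  "((\<lambda>t. (norm (\<Sum>n<N. c n * cis (real n * t)))\<^sup>2) has_integral
     2 * pi * (\<Sum>n<N. (norm (c n))\<^sup>2)) {0..2 * pi}"
proof -
  have "cis (real_of_int (int n - int m) * t) = cis (real n * t) * cnj (cis (real m * t))"
    for n m t
    by (simp add: cis_cnj cis_mult algebra_simps)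
  then have expand: "of_real ((norm (\<Sum>n<N. c n * cis (real n * t)))\<^sup>2)
      = (\<Sum>n<N. \<Sum>m<N. c n * cnj (c m) * cis (real_of_int (int n - int m) * t))" for t
    unfolding complex_norm_square cnj_sum sum_product by (simp add: mult_ac)
  have "((\<lambda>t. complex_of_real ((norm (\<Sum>n<N. c n * cis (real n * t)))\<^sup>2)) has_integral
      (\<Sum>n<N. \<Sum>m<N. c n * cnj (c m) *
        (if int n - int m = 0 then of_real (2 * pi) else 0))) {0..2 * pi}"
    unfolding expand
    by (intro has_integral_sum has_integral_mult_right integral_cis) auto
  moreover have "(\<Sum>n<N. \<Sum>m<N. c n * cnj (c m) *
        (if int n - int m = 0 then of_real (2 * pi) else 0))
      = of_real (2 * pi * (\<Sum>n<N. (norm (c n))\<^sup>2))"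
    by (simp add: complex_norm_square if_distrib[of "(*) _"] sum.delta sum_distrib_left mult_ac
        del: of_real_power cong: if_cong)
  ultimately have "((\<lambda>t. complex_of_real ((norm (\<Sum>n<N. c n * cis (real n * t)))\<^sup>2)) has_integral
      of_real (2 * pi * (\<Sum>n<N. (norm (c n))\<^sup>2))) {0..2 * pi}"
    by (simp only:)
  from has_integral_linear[OF this bounded_linear_Re] show ?thesis
    by (simp only: o_def Re_complex_of_real)
qed

text \<open>Parseval's identity. The partial sums of the Taylor series are trigonometric polynomials on the
circle of radius \<open>r\<close>, uniformly bounded by the absolutely convergent majorant, so their square means
converge.\<close>

lemma circle_mean_sums:
  assumes f: "f \<in> hol_disc" and r: "r \<in> {0..<1}"
  shows "(\<lambda>n. (norm (coef f n))\<^sup>2 * r ^ (2 * n)) sums circle_mean f r"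
proof -
  define S where "S N t = (\<Sum>n<N. (coef f n * of_real r ^ n) * cis (real n * t))" for N t
  have rd: "of_real r * cis t \<in> disc" for t using r by (simp add: norm_mult)
  have S: "(\<lambda>N. S N t) \<longlonglongrightarrow> f (of_real r * cis t)" for t
    using coef_sums[OF f rd, of t]
    by (simp add: S_def sums_def power_mult_distrib Complex.DeMoivre mult.assoc)
  have abs: "summable (\<lambda>n. norm (coef f n) * r ^ n)"
  proof -
    \<comment> \<open>Convergence at a larger radius gives absolute convergence at \<open>r\<close>.\<close>
    obtain s where s: "r < s" "s < 1" using r dense[of r 1] by auto
    have "summable (\<lambda>n. coef f n * of_real s ^ n)"
      using coef_sums[OF f, of "of_real s"] s r by (auto simp: sums_iff)
    from powser_insidea[OF this, of "of_real r"] show ?thesis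
      using r s by (simp add: norm_mult norm_power)
  qed
  define B where "B = (\<Sum>n. norm (coef f n) * r ^ n)"
  have SB: "norm (S N t) \<le> B" for N t
  proof -
    have "norm (S N t) \<le> (\<Sum>n<N. norm (coef f n) * r ^ n)"
      unfolding S_def using r
      by (intro order_trans[OF norm_sum] sum_mono) (simp add: norm_mult norm_power)
    also have "\<dots> \<le> B" unfolding B_def using r by (intro sum_le_suminf abs) auto
    finally show ?thesis .
  qed
  have int: "((\<lambda>t. (norm (S N t))\<^sup>2) has_integral
      2 * pi * (\<Sum>n<N. (norm (coef f n))\<^sup>2 * r ^ (2 * n))) {0..2 * pi}" for N
    using integral_norm_trig_poly[of "\<lambda>n. coef f n * of_real r ^ n" N] r
    by (simp add: S_def norm_mult norm_power power_mult_distrib power_mult[symmetric] mult.commute)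
  have "(\<lambda>N. integral {0..2 * pi} (\<lambda>t. (norm (S N t))\<^sup>2))
      \<longlonglongrightarrow> integral {0..2 * pi} (\<lambda>t. (norm (f (of_real r * cis t)))\<^sup>2)"
  proof (rule dominated_convergence)
    show "(\<lambda>t. (norm (S N t))\<^sup>2) integrable_on {0..2 * pi}" for N
      using int by blast
    show "(\<lambda>t. B\<^sup>2) integrable_on {0..2 * pi}" by (rule integrable_const_ivl)
    show "norm ((norm (S N t))\<^sup>2) \<le> B\<^sup>2" for N t
      using SB[of N t] by (simp add: power_mono)
    show "(\<lambda>N. (norm (S N t))\<^sup>2) \<longlonglongrightarrow> (norm (f (of_real r * cis t)))\<^sup>2" for t
      by (intro tendsto_intros S)
  qed
  from tendsto_divide[OF this tendsto_const[of "2 * pi"]] show ?thesis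
    by (simp add: sums_def circle_mean_def integral_unique[OF int])
qed

lemma circle_mean_mono:
  assumes f: "f \<in> hol_disc" and "0 \<le> r" "r \<le> s" "s < 1"
  shows "circle_mean f r \<le> circle_mean f s"
  by (rule sums_le[OF _ circle_mean_sums[OF f] circle_mean_sums[OF f]])
    (use assms in \<open>auto intro!: mult_left_mono power_mono\<close>)

lemma sum_coef_le:
  assumes f: "f \<in> H2"
  shows "(\<Sum>n<N. (norm (coef f n))\<^sup>2) \<le> (H2_norm f)\<^sup>2"
proof (rule tendsto_upperbound)
  have hol: "f \<in> hol_disc" using f by (simp add: H2_def)
  show "((\<lambda>r. \<Sum>n<N. (norm (coef f n))\<^sup>2 * r ^ (2 * n))
      \<longlongrightarrow> (\<Sum>n<N. (norm (coef f n))\<^sup>2)) (at_left 1)"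
    by (rule tendsto_eq_intros refl | simp)+
  have "(\<Sum>n<N. (norm (coef f n))\<^sup>2 * r ^ (2 * n)) \<le> (H2_norm f)\<^sup>2" if r: "r \<in> {0<..<1}" for r
  proof -
    have "(\<Sum>n<N. (norm (coef f n))\<^sup>2 * r ^ (2 * n)) \<le> circle_mean f r"
    proof -
      have *: "(\<lambda>n. (norm (coef f n))\<^sup>2 * r ^ (2 * n)) sums circle_mean f r"
        using r by (intro circle_mean_sums[OF hol]) simp
      show ?thesis
        unfolding sums_unique[OF *] by (rule sum_le_suminf[OF sums_summable[OF *]]) (use r in auto)
    qed
    also have "\<dots> \<le> (H2_norm f)\<^sup>2" using circle_mean_le_H2_norm[OF f] r by simp
    finally show ?thesis .
  qed
  then show "\<forall>\<^sub>F r in at_left 1. (\<Sum>n<N. (norm (coef f n))\<^sup>2 * r ^ (2 * n)) \<le> (H2_norm f)\<^sup>2"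
    using eventually_at_left_real[of 0 1] by (auto elim: eventually_mono)
qed simp

lemma summable_coef:
  assumes "f \<in> H2"
  shows "summable (\<lambda>n. (norm (coef f n))\<^sup>2)"
  by (rule bounded_imp_summable[of _ "(H2_norm f)\<^sup>2"])
    (use sum_coef_le[OF assms, of "Suc _"] in \<open>auto simp: lessThan_Suc_atMost\<close>)

lemma H2_norm_eq_suminf:
  assumes f: "f \<in> H2"
  shows "(H2_norm f)\<^sup>2 = (\<Sum>n. (norm (coef f n))\<^sup>2)"
proof (rule antisym)
  show "(\<Sum>n. (norm (coef f n))\<^sup>2) \<le> (H2_norm f)\<^sup>2"
    by (rule suminf_le_const[OF summable_coef[OF f] sum_coef_le[OF f]])
  have hol: "f \<in> hol_disc" using f by (simp add: H2_def)
  have pos: "0 \<le> (\<Sum>n. (norm (coef f n))\<^sup>2)"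
    by (rule suminf_nonneg[OF summable_coef[OF f]]) simp
  have "H2_norm f \<le> sqrt (\<Sum>n. (norm (coef f n))\<^sup>2)"
  proof (rule H2_norm_le)
    fix r :: real assume r: "r \<in> {0..<1}"
    have "circle_mean f r \<le> (\<Sum>n. (norm (coef f n))\<^sup>2)"
      by (rule sums_le[OF _ circle_mean_sums[OF hol r] summable_sums[OF summable_coef[OF f]]])
        (use r in \<open>auto intro!: mult_right_le_one_le power_le_one\<close>)
    then show "circle_mean f r \<le> (sqrt (\<Sum>n. (norm (coef f n))\<^sup>2))\<^sup>2" using pos by simp
  qed (use pos in simp)
  then show "(H2_norm f)\<^sup>2 \<le> (\<Sum>n. (norm (coef f n))\<^sup>2)"
    using power_mono[OF _ H2_norm_nonneg[OF f], of _ 2] pos by fastforce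
qed

lemma norm_coef_le_H2_norm:
  assumes f: "f \<in> H2"
  shows "norm (coef f n) \<le> H2_norm f"
proof -
  have "(norm (coef f n))\<^sup>2 \<le> (\<Sum>k<Suc n. (norm (coef f k))\<^sup>2)"
    by (rule member_le_sum) auto
  also have "\<dots> \<le> (H2_norm f)\<^sup>2" by (rule sum_coef_le[OF f])
  finally show ?thesis by (rule power2_le_imp_le[OF _ H2_norm_nonneg[OF f]])
qed

section \<open>Bounded functions and polynomials in the Hardy space\<close>

lemma HinfI:
  assumes "f holomorphic_on disc" "\<And>z. z \<in> disc \<Longrightarrow> norm (f z) \<le> B" "\<And>z. z \<notin> disc \<Longrightarrow> f z = 0"
  shows "f \<in> Hinf"
proof -
  have "bounded (f ` disc)" using assms(2) by (intro boundedI[of _ B]) blast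
  then show ?thesis using assms(1,3) by (simp add: Hinf_def hol_disc_def)
qed

lemma Hinf_hol: "f \<in> Hinf \<Longrightarrow> f holomorphic_on disc"
  and Hinf_outside: "f \<in> Hinf \<Longrightarrow> z \<notin> disc \<Longrightarrow> f z = 0"
  and Hinf_hol_disc: "f \<in> Hinf \<Longrightarrow> f \<in> hol_disc"
  and Hinf_H2: "f \<in> Hinf \<Longrightarrow> f \<in> H2"
  and H2_hol_disc: "f \<in> H2 \<Longrightarrow> f \<in> hol_disc"
  using Hinf_subset_H2 by (auto simp: Hinf_def hol_disc_def H2_def)

lemma Hinf_mult:
  assumes "f \<in> Hinf" "g \<in> Hinf"
  shows "(\<lambda>z. f z * g z) \<in> Hinf"
proof (rule HinfI)
  show "norm (f z * g z) \<le> sup_norm f * sup_norm g" if "z \<in> disc" for z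
    unfolding norm_mult
    by (intro mult_mono sup_norm_ge sup_norm_nonneg assms that norm_ge_zero)
qed (use assms in \<open>auto intro: holomorphic_on_mult Hinf_hol Hinf_outside\<close>)

lemma Hinf_cmult: "f \<in> Hinf \<Longrightarrow> (\<lambda>z. c * f z) \<in> Hinf"
  by (rule HinfI[of _ "norm c * sup_norm f"])
    (simp_all add: holomorphic_on_mult Hinf_hol Hinf_outside norm_mult mult_left_mono sup_norm_ge)

definition poly_disc :: "nat \<Rightarrow> (nat \<Rightarrow> complex) \<Rightarrow> complex \<Rightarrow> complex" where
  "poly_disc N c = (\<lambda>z. if z \<in> disc then \<Sum>k<N. c k * z ^ k else 0)"

lemma poly_disc_Hinf: "poly_disc N c \<in> Hinf"
proof (rule HinfI)
  have "(\<lambda>z. \<Sum>k<N. c k * z ^ k) holomorphic_on disc"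
    by (intro holomorphic_intros)
  then show "poly_disc N c holomorphic_on disc"
    by (rule holomorphic_transform) (simp add: poly_disc_def)
  show "norm (poly_disc N c z) \<le> (\<Sum>k<N. norm (c k))" if "z \<in> disc" for z
    using that by (auto simp: poly_disc_def norm_mult norm_power
        intro!: sum_norm_le mult_right_le_one_le power_le_one)
qed (auto simp: poly_disc_def)

text \<open>Makes it possible to read off the coefficients of functions that are given by cases, such as
polynomials cut off outside the disc, whose higher derivatives are awkward to compute.\<close>

lemma coef_unique:
  assumes "\<And>z. z \<in> disc \<Longrightarrow> (\<lambda>n. a n * z ^ n) sums f z"
  shows "coef f n = a n"
proof -
  have "f has_fps_expansion Abs_fps a"
  proof (rule has_fps_expansionI)
    have "\<forall>\<^sub>F z in nhds 0. z \<in> disc" by (rule eventually_nhds_in_open) auto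
    then show "\<forall>\<^sub>F z in nhds 0. (\<lambda>n. fps_nth (Abs_fps a) n * z ^ n) sums f z"
      by eventually_elim (simp add: assms)
  qed
  from fps_nth_fps_expansion[OF this, of n] show ?thesis by (simp add: coef_def)
qed

lemma coef_poly_disc: "coef (poly_disc N c) n = (if n < N then c n else 0)"
proof (rule coef_unique)
  fix z :: complex assume "z \<in> disc"
  then show "(\<lambda>n. (if n < N then c n else 0) * z ^ n) sums poly_disc N c z"
    using sums_If_finite_set[of "{..<N}" "\<lambda>n. c n * z ^ n"]
    by (simp add: poly_disc_def if_distrib[of "\<lambda>x. x * _"] cong: if_cong)
qed

lemma H2_norm_taylor_remainder:
  assumes f: "f \<in> H2"
  shows "(H2_norm (\<lambda>z. f z - poly_disc N (coef f) z))\<^sup>2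
    = (H2_norm f)\<^sup>2 - (\<Sum>n<N. (norm (coef f n))\<^sup>2)"
proof -
  note P = Hinf_H2[OF poly_disc_Hinf]
  have c: "(norm (coef (\<lambda>z. f z - poly_disc N (coef f) z) n))\<^sup>2
      = (norm (coef f n))\<^sup>2 - (if n \<in> {..<N} then (norm (coef f n))\<^sup>2 else 0)" for n
    by (simp add: coef_diff[OF H2_hol_disc[OF f] H2_hol_disc[OF P]] coef_poly_disc)
  have fin: "(\<lambda>n. if n \<in> {..<N} then (norm (coef f n))\<^sup>2 else 0)
      sums (\<Sum>n<N. (norm (coef f n))\<^sup>2)"
    by (rule sums_If_finite_set) simp
  show ?thesis
    unfolding H2_norm_eq_suminf[OF H2_diff[OF f P]] H2_norm_eq_suminf[OF f] c
    using sums_diff[OF summable_sums[OF summable_coef[OF f]] fin] by (simp add: sums_iff)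
qed

definition const_disc :: "complex \<Rightarrow> complex \<Rightarrow> complex" where
  "const_disc c = (\<lambda>z. if z \<in> disc then c else 0)"

lemma const_disc_Hinf: "const_disc c \<in> Hinf"
  by (rule HinfI[of _ "norm c"])
    (auto simp: const_disc_def intro: holomorphic_transform[of "\<lambda>_. c"])

lemma H2_norm_diff_const:
  assumes f: "f \<in> H2"
  shows "(H2_norm (\<lambda>z. f z - const_disc (f 0) z))\<^sup>2 = (H2_norm f)\<^sup>2 - (norm (f 0))\<^sup>2"
  using H2_norm_taylor_remainder[OF f, of 1]
  by (simp add: poly_disc_def const_disc_def cong: if_cong)

lemma polynomials_dense_H2:
  assumes f: "f \<in> H2" and e: "e > 0"
  obtains N where "H2_norm (\<lambda>z. f z - poly_disc N (coef f) z) < e"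
proof -
  have "(\<lambda>N. (H2_norm f)\<^sup>2 - (\<Sum>n<N. (norm (coef f n))\<^sup>2)) \<longlonglongrightarrow> (H2_norm f)\<^sup>2 - (H2_norm f)\<^sup>2"
    unfolding H2_norm_eq_suminf[OF f]
    by (intro tendsto_diff tendsto_const summable_LIMSEQ summable_coef f)
  then have "\<forall>\<^sub>F N in sequentially. (H2_norm f)\<^sup>2 - (\<Sum>n<N. (norm (coef f n))\<^sup>2) < e\<^sup>2"
    using e by (intro order_tendstoD(2)[where y = 0]) auto
  then obtain N where "(H2_norm (\<lambda>z. f z - poly_disc N (coef f) z))\<^sup>2 < e\<^sup>2"
    unfolding H2_norm_taylor_remainder[OF f] eventually_sequentially by auto
  from power_less_imp_less_base[OF this] e have "H2_norm (\<lambda>z. f z - poly_disc N (coef f) z) < e"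
    by simp
  then show ?thesis by (rule that)
qed

text \<open>Products with bounded functions and scalar multiples are all estimated through this pointwise
bound, which the circle means inherit by monotonicity of the integral.\<close>

lemma H2_domination:
  assumes h: "h \<in> hol_disc" and g: "g \<in> H2" and B: "0 \<le> B"
    and le: "\<And>z. z \<in> disc \<Longrightarrow> norm (h z) \<le> B * norm (g z)"
  shows "h \<in> H2" "H2_norm h \<le> B * H2_norm g"
proof -
  have le: "circle_mean h r \<le> (B * H2_norm g)\<^sup>2" if r: "r \<in> {0..<1}" for r
  proof -
    have "(norm (h z))\<^sup>2 \<le> B\<^sup>2 * (norm (g z))\<^sup>2 + 0 * (norm (g z))\<^sup>2" if "z \<in> disc" for z
      using power_mono[OF le[OF that], of 2] by (simp add: power_mult_distrib)
    then have "circle_mean h r \<le> B\<^sup>2 * circle_mean g r + 0 * circle_mean g r"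
      by (rule circle_mean_le[OF H2_hol_disc[OF g] H2_hol_disc[OF g] h r])
    also have "\<dots> \<le> B\<^sup>2 * (H2_norm g)\<^sup>2"
      using circle_mean_le_H2_norm[OF g r] by (simp add: mult_left_mono)
    finally show ?thesis by (simp add: power_mult_distrib)
  qed
  show "h \<in> H2" unfolding H2_def using h bdd_aboveI2[of "{0..<1}", OF le] by simp
  show "H2_norm h \<le> B * H2_norm g"
    by (rule H2_norm_le[OF _ le]) (use B H2_norm_nonneg[OF g] in auto)
qed

section \<open>Comparison of Hardy norms by radial limits\<close>

text \<open>The comparison needs no boundary function: the excess of \<open>\<bar>a\<bar>\<^sup>2\<close> over \<open>\<bar>b\<bar>\<^sup>2\<close> is bounded by
\<open>(sup_norm a)\<^sup>2\<close> and tends to zero along almost every radius, so by dominated convergence its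
mean over the circles tends to zero. Circle means increase with the radius, hence circles
close to the unit circle control all the others.\<close>

lemma H2_norm_le_if_radially_le:
  assumes a: "a \<in> Hinf" and b: "b \<in> Hinf"
    and le: "AE t in lebesgue_on {0..2 * pi}. \<forall>e>0. \<forall>\<^sub>F r in at_left 1.
      (norm (a (of_real r * cis t)))\<^sup>2 \<le> (norm (b (of_real r * cis t)))\<^sup>2 + e"
  shows "H2_norm a \<le> H2_norm b"
proof (rule H2_norm_le)
  show "0 \<le> H2_norm b" by (rule H2_norm_nonneg[OF Hinf_H2[OF b]])
  fix r :: real assume r: "r \<in> {0..<1}"
  \<comment> \<open>Dominated convergence is a statement about sequences, so let the radius tend to \<open>1\<close> along one.\<close>
  define R where "R i = 1 - 1 / real (i + 2)" for i
  have R: "R i \<in> {0..<1}" for i by (simp add: R_def)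
  have "(\<lambda>i. 1 / real (i + 2)) \<longlonglongrightarrow> 0"
    using LIMSEQ_ignore_initial_segment[OF lim_1_over_n, of 2] by simp
  from tendsto_diff[OF tendsto_const[of 1] this] have Rlim: "R \<longlonglongrightarrow> 1"
    by (simp add: R_def[abs_def])
  then have Rlim': "filterlim R (at_left 1) sequentially"
    using R by (auto simp: filterlim_at less_imp_neq)
  define A where "A i t = (norm (a (of_real (R i) * cis t)))\<^sup>2" for i t
  define B where "B i t = (norm (b (of_real (R i) * cis t)))\<^sup>2" for i t
  define s where "s i t = max 0 (A i t - B i t)" for i t
  let ?M = "lebesgue_on {0..2 * pi}"
  note contA = continuous_circle[OF Hinf_hol_disc[OF a] R]
  note contB = continuous_circle[OF Hinf_hol_disc[OF b] R]
  have cont_s: "continuous_on {0..2 * pi} (s i)" for i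
    unfolding s_def A_def B_def by (intro continuous_intros contA contB)
  have int_s: "integrable ?M (s i)" for i
    using cont_s by (simp add: continuous_imp_integrable_real)
  have "(\<lambda>i. integral\<^sup>L ?M (s i)) \<longlonglongrightarrow> integral\<^sup>L ?M (\<lambda>_. 0)"
  proof (rule integral_dominated_convergence)
    show "s i \<in> borel_measurable ?M" for i using int_s by auto
    show "integrable ?M (\<lambda>_. (sup_norm a)\<^sup>2)"
      by (rule continuous_imp_integrable_real) simp
    show "AE t in ?M. norm (s i t) \<le> (sup_norm a)\<^sup>2" for i
    proof (rule AE_I2)
      fix t
      have "A i t \<le> (sup_norm a)\<^sup>2"
        unfolding A_def using R[of i] by (intro power_mono sup_norm_ge[OF a]) (auto simp: norm_mult)
      moreover have "0 \<le> B i t" by (simp add: B_def)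
      ultimately show "norm (s i t) \<le> (sup_norm a)\<^sup>2"
        by (auto simp: s_def max_def)
    qed
    show "AE t in ?M. (\<lambda>i. s i t) \<longlonglongrightarrow> 0"
      using le
    proof eventually_elim
      case (elim t)
      show ?case
      proof (rule tendstoI)
        fix e :: real assume e: "e > 0"
        have "\<forall>\<^sub>F i in sequentially. A i t \<le> B i t + e / 2"
          unfolding A_def B_def
          by (rule eventually_compose_filterlim[OF _ Rlim']) (use elim e in simp)
        then show "\<forall>\<^sub>F i in sequentially. dist (s i t) 0 < e"
          by eventually_elim (use e in \<open>auto simp: s_def max_def\<close>)
      qed
    qed
  qed simp
  then have lim: "(\<lambda>i. integral {0..2 * pi} (s i)) \<longlonglongrightarrow> 0"
    using int_s by (simp add: lebesgue_integral_eq_integral)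
  have bound: "circle_mean a (R i) \<le> (H2_norm b)\<^sup>2 + integral {0..2 * pi} (s i) / (2 * pi)" for i
  proof -
    have "integral {0..2 * pi} (A i) \<le> integral {0..2 * pi} (\<lambda>t. B i t + s i t)"
      unfolding A_def B_def
      by (intro integral_le integrable_add integrable_continuous_interval contA contB cont_s)
        (auto simp: s_def A_def B_def)
    also have "\<dots> = integral {0..2 * pi} (B i) + integral {0..2 * pi} (s i)"
      unfolding B_def by (intro integral_add integrable_continuous_interval contB cont_s)
    finally have "circle_mean a (R i) \<le> circle_mean b (R i) + integral {0..2 * pi} (s i) / (2 * pi)"
      by (simp add: circle_mean_def A_def[abs_def] B_def[abs_def] add_divide_distrib[symmetric]
          divide_right_mono)
    also have "circle_mean b (R i) \<le> (H2_norm b)\<^sup>2"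
      by (rule circle_mean_le_H2_norm[OF Hinf_H2[OF b] R])
    finally show ?thesis by simp
  qed
  show "circle_mean a r \<le> (H2_norm b)\<^sup>2"
  proof (rule tendsto_lowerbound)
    show "(\<lambda>i. (H2_norm b)\<^sup>2 + integral {0..2 * pi} (s i) / (2 * pi)) \<longlonglongrightarrow> (H2_norm b)\<^sup>2"
      using tendsto_add[OF tendsto_const tendsto_divide[OF lim tendsto_const[of "2 * pi"]]]
      by simp
    have "\<forall>\<^sub>F i in sequentially. r < R i" using order_tendstoD(1)[OF Rlim] r by simp
    then show "\<forall>\<^sub>F i in sequentially.
        circle_mean a r \<le> (H2_norm b)\<^sup>2 + integral {0..2 * pi} (s i) / (2 * pi)"
    proof eventually_elim
      case (elim i)
      then have "circle_mean a r \<le> circle_mean a (R i)"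
        using r R[of i] by (intro circle_mean_mono[OF Hinf_hol_disc[OF a]]) auto
      with bound[of i] show ?case by simp
    qed
  qed simp
qed

text \<open>Only the modulus is required to converge radially. A quotient of inner functions visibly has this
property, and it is all that the norm comparison needs.\<close>

definition radially_unimodular :: "(complex \<Rightarrow> complex) \<Rightarrow> bool" where
  "radially_unimodular u \<longleftrightarrow> (AE t in lebesgue_on {0..2 * pi}.
     ((\<lambda>r. norm (u (of_real r * cis t))) \<longlongrightarrow> 1) (at_left 1))"

lemma inner_funs_Hinf: "u \<in> inner_funs \<Longrightarrow> u \<in> Hinf"
  by (simp add: inner_funs_def)

lemma inner_funs_radially_unimodular:
  assumes "u \<in> inner_funs"
  shows "radially_unimodular u"
  unfolding radially_unimodular_def
proof (rule AE_mp)
  show "AE t in lebesgue_on {0..2 * pi}.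
     \<exists>w. ((\<lambda>r. u (of_real r * cis t)) \<longlongrightarrow> w) (at_left 1) \<and> norm w = 1"
    using assms by (simp add: inner_funs_def)
qed (auto intro!: AE_I2 dest: tendsto_norm)

lemma eventually_radius_in_disc: "\<forall>\<^sub>F r in at_left (1::real). of_real r * cis t \<in> disc"
  using eventually_at_left_real[OF zero_less_one] by eventually_elim (auto simp: norm_mult)

text \<open>The difference between \<open>\<bar>u f\<bar>\<^sup>2\<close> and \<open>\<bar>f\<bar>\<^sup>2\<close> vanishes along almost every radius because \<open>f\<close> is bounded;
the radial comparison then applies in both directions.\<close>

lemma H2_norm_mult_radially_unimodular:
  assumes u: "u \<in> Hinf" "radially_unimodular u" and f: "f \<in> Hinf"
  shows "H2_norm (\<lambda>z. u z * f z) = H2_norm f"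
proof -
  define B where "B = (sup_norm f)\<^sup>2 + 1"
  have B: "B > 0" by (simp add: B_def add_nonneg_pos)
  have close: "AE t in lebesgue_on {0..2 * pi}. \<forall>e>0. \<forall>\<^sub>F r in at_left 1.
      \<bar>(norm (u (of_real r * cis t) * f (of_real r * cis t)))\<^sup>2 - (norm (f (of_real r * cis t)))\<^sup>2\<bar> \<le> e"
    using u(2)[unfolded radially_unimodular_def]
  proof eventually_elim
    case (elim t)
    have lim: "((\<lambda>r. (norm (u (of_real r * cis t)))\<^sup>2) \<longlongrightarrow> 1) (at_left 1)"
      using tendsto_power[OF elim, of 2] by simp
    show ?case
    proof (intro allI impI)
      fix e :: real assume "e > 0"
      then have "\<forall>\<^sub>F r in at_left 1. \<bar>(norm (u (of_real r * cis t)))\<^sup>2 - 1\<bar> < e / B"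
        using tendstoD[OF lim, of "e / B"] B by (simp add: dist_real_def)
      then show "\<forall>\<^sub>F r in at_left 1. \<bar>(norm (u (of_real r * cis t) * f (of_real r * cis t)))\<^sup>2
          - (norm (f (of_real r * cis t)))\<^sup>2\<bar> \<le> e"
        using eventually_radius_in_disc[of t]
      proof eventually_elim
        case (elim r)
        define X Y where "X = (norm (u (of_real r * cis t)))\<^sup>2"
          and "Y = (norm (f (of_real r * cis t)))\<^sup>2"
        have "Y \<le> B"
          unfolding B_def Y_def using power_mono[OF sup_norm_ge[OF f elim(2)], of 2] by simp
        moreover have "0 \<le> Y" by (simp add: Y_def)
        ultimately have "\<bar>X - 1\<bar> * \<bar>Y\<bar> \<le> e / B * B"
          using elim(1) B by (intro mult_mono) (auto simp: X_def)
        then have "\<bar>X * Y - Y\<bar> \<le> e"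
          using B by (simp only: abs_mult[symmetric] left_diff_distrib) simp
        then show ?case by (simp only: X_def Y_def norm_mult power_mult_distrib)
      qed
    qed
  qed
  have le: "x \<le> y + e" "y \<le> x + e" if "\<bar>x - y\<bar> \<le> e" for x y e :: real
    using that by linarith+
  show ?thesis
  proof (rule antisym)
    show "H2_norm (\<lambda>z. u z * f z) \<le> H2_norm f"
    proof (rule H2_norm_le_if_radially_le[OF Hinf_mult[OF u(1) f] f])
      show "AE t in lebesgue_on {0..2 * pi}. \<forall>e>0. \<forall>\<^sub>F r in at_left 1.
          (norm (u (of_real r * cis t) * f (of_real r * cis t)))\<^sup>2
            \<le> (norm (f (of_real r * cis t)))\<^sup>2 + e"
        using close
      proof eventually_elim
        case (elim t)
        show ?case
        proof (intro allI impI)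
          fix e :: real assume "e > 0"
          from elim[rule_format, OF this] show "\<forall>\<^sub>F r in at_left 1. (norm (u (of_real r * cis t) * f (of_real r * cis t)))\<^sup>2
              \<le> (norm (f (of_real r * cis t)))\<^sup>2 + e"
            by eventually_elim (rule le(1))
        qed
      qed
    qed
    show "H2_norm f \<le> H2_norm (\<lambda>z. u z * f z)"
    proof (rule H2_norm_le_if_radially_le[OF f Hinf_mult[OF u(1) f]])
      show "AE t in lebesgue_on {0..2 * pi}. \<forall>e>0. \<forall>\<^sub>F r in at_left 1.
          (norm (f (of_real r * cis t)))\<^sup>2
            \<le> (norm (u (of_real r * cis t) * f (of_real r * cis t)))\<^sup>2 + e"
        using close
      proof eventually_elim
        case (elim t)
        show ?case
        proof (intro allI impI)
          fix e :: real assume "e > 0"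
          from elim[rule_format, OF this] show "\<forall>\<^sub>F r in at_left 1. (norm (f (of_real r * cis t)))\<^sup>2
              \<le> (norm (u (of_real r * cis t) * f (of_real r * cis t)))\<^sup>2 + e"
            by eventually_elim (rule le(2))
        qed
      qed
    qed
  qed
qed

lemma H2_norm_const_disc: "H2_norm (const_disc c) = norm c"
proof -
  have "const_disc c = poly_disc 1 (\<lambda>_. c)" by (simp add: const_disc_def poly_disc_def cong: if_cong)
  then have *: "coef (const_disc c) n = (if n = 0 then c else 0)" for n
    by (simp add: coef_poly_disc)
  have "(\<lambda>n. (norm (coef (const_disc c) n))\<^sup>2) sums (norm c)\<^sup>2"
    using sums_If_finite_set[of "{0}" "\<lambda>_::nat. (norm c)\<^sup>2"]
    by (simp add: * if_distrib[of norm] if_distrib[of "\<lambda>x. x\<^sup>2"] cong: if_cong)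
  then have "(H2_norm (const_disc c))\<^sup>2 = (norm c)\<^sup>2"
    by (simp add: H2_norm_eq_suminf[OF Hinf_H2[OF const_disc_Hinf]] sums_iff)
  then show ?thesis
    using H2_norm_nonneg[OF Hinf_H2[OF const_disc_Hinf]] by simp
qed

lemma H2_norm_radially_unimodular:
  assumes "u \<in> Hinf" "radially_unimodular u"
  shows "H2_norm u = 1"
proof -
  have "(\<lambda>z. u z * const_disc 1 z) = u"
    using Hinf_outside[OF assms(1)] by (auto simp: const_disc_def fun_eq_iff)
  then show ?thesis
    using H2_norm_mult_radially_unimodular[OF assms const_disc_Hinf[of 1]]
    by (simp add: H2_norm_const_disc)
qed

section \<open>Invertible functions are outer\<close>

lemma Hinf_invD:
  assumes "h \<in> Hinf_inv"
  shows "h \<in> Hinf" "\<And>z. z \<in> disc \<Longrightarrow> h z \<noteq> 0" "(\<lambda>z. inverse (h z)) \<in> Hinf"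
proof -
  obtain g where g: "h \<in> Hinf" "g \<in> Hinf" "\<And>z. z \<in> disc \<Longrightarrow> h z * g z = 1"
    using assms by (auto simp: Hinf_inv_def)
  have "inverse (h z) = g z" for z
    by (cases "z \<in> disc") (use g in \<open>auto simp: Hinf_outside intro: inverse_unique\<close>)
  then have "(\<lambda>z. inverse (h z)) = g" by auto
  then show "h \<in> Hinf" "(\<lambda>z. inverse (h z)) \<in> Hinf" using g by simp_all
  show "h z \<noteq> 0" if "z \<in> disc" for z using g(3)[OF that] by auto
qed

lemma Hinf_inv_cmult:
  assumes "h \<in> Hinf_inv" "c \<noteq> 0"
  shows "(\<lambda>z. c * h z) \<in> Hinf_inv"
  unfolding Hinf_inv_def
  using Hinf_cmult[OF Hinf_invD(1)[OF assms(1)], of c]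
    Hinf_cmult[OF Hinf_invD(3)[OF assms(1)], of "inverse c"] Hinf_invD(2)[OF assms(1)] assms(2)
  by (auto intro!: bexI[of _ "\<lambda>z. inverse c * inverse (h z)"] simp: field_simps)

lemma shift_span_eq: "shift_span F = {(\<lambda>z. (\<Sum>k<N. c k * z ^ k) * F z) | N c. True}"
  by (simp add: shift_span_def sum_distrib_right mult.assoc)

lemma shift_span_poly_disc:
  assumes F: "F \<in> Hinf"
  shows "(\<lambda>z. (\<Sum>k<N. c k * z ^ k) * F z) = (\<lambda>z. poly_disc N c z * F z)"
  using Hinf_outside[OF F] by (auto simp: poly_disc_def fun_eq_iff)

lemma outer_funs_iff:
  assumes F: "F \<in> Hinf"
  shows "F \<in> outer_funs \<longleftrightarrow>
    (\<forall>g\<in>H2. \<forall>e>0. \<exists>N c. H2_norm (\<lambda>z. g z - poly_disc N c z * F z) < e)"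
proof -
  interpret Metric_space H2 H2_dist by (rule Metric_space_H2_dist)
  have span: "(\<lambda>z. poly_disc N c z * F z) \<in> H2" for N c
    by (intro Hinf_H2 Hinf_mult poly_disc_Hinf F)
  have "H2_top H2 closure_of shift_span F =
      {g \<in> H2. \<forall>e>0. \<exists>N c. H2_norm (\<lambda>z. g z - poly_disc N c z * F z) < e}"
  proof -
    have "(\<exists>y\<in>shift_span F. y \<in> mball g e)
        \<longleftrightarrow> (\<exists>N c. H2_norm (\<lambda>z. g z - poly_disc N c z * F z) < e)" if g: "g \<in> H2" for g e
    proof -
      have "(\<exists>y\<in>shift_span F. y \<in> mball g e) \<longleftrightarrow> (\<exists>N c. (\<lambda>z. poly_disc N c z * F z) \<in> mball g e)"
        unfolding shift_span_eq shift_span_poly_disc[OF F] by blast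
      then show ?thesis by (simp only: in_mball g span H2_dist_def if_True simp_thms)
    qed
    then show ?thesis unfolding metric_closure_of by blast
  qed
  then have "F \<in> outer_funs \<longleftrightarrow>
      {g \<in> H2. \<forall>e>0. \<exists>N c. H2_norm (\<lambda>z. g z - poly_disc N c z * F z) < e} = H2"
    using F by (simp add: outer_funs_def)
  also have "\<dots> \<longleftrightarrow> (\<forall>g\<in>H2. \<forall>e>0. \<exists>N c. H2_norm (\<lambda>z. g z - poly_disc N c z * F z) < e)"
    by blast
  finally show ?thesis .
qed

text \<open>To approximate \<open>g\<close> by polynomial multiples of \<open>h\<close>, approximate \<open>g / h\<close>, which again lies in the
Hardy space, by its Taylor polynomials and multiply by the bounded function \<open>h\<close>.\<close>

lemma Hinf_inv_outer:
  assumes h: "h \<in> Hinf_inv"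
  shows "h \<in> outer_funs"
  unfolding outer_funs_iff[OF Hinf_invD(1)[OF h]]
proof (intro ballI allI impI)
  fix g and e :: real assume g: "g \<in> H2" and e: "e > 0"
  note hD = Hinf_invD[OF h]
  define q where "q = (\<lambda>z. inverse (h z) * g z)"
  define B where "B = sup_norm h + 1"
  have B: "B > 0" using sup_norm_nonneg[OF hD(1)] by (simp add: B_def)
  have q: "q \<in> H2"
  proof (rule H2_domination)
    show "q \<in> hol_disc"
      using Hinf_hol_disc[OF hD(3)] H2_hol_disc[OF g]
      by (auto simp: hol_disc_def q_def intro!: holomorphic_on_mult)
    show "norm (q z) \<le> sup_norm (\<lambda>z. inverse (h z)) * norm (g z)" if "z \<in> disc" for z
      unfolding q_def norm_mult by (intro mult_right_mono sup_norm_ge[OF hD(3)] that) simp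
  qed (use g sup_norm_nonneg[OF hD(3)] in auto)
  obtain N where N: "H2_norm (\<lambda>z. q z - poly_disc N (coef q) z) < e / B"
    using polynomials_dense_H2[OF q, of "e / B"] e B by auto
  let ?p = "poly_disc N (coef q)"
  have d: "(\<lambda>z. q z - ?p z) \<in> H2" by (rule H2_diff[OF q Hinf_H2[OF poly_disc_Hinf]])
  have "H2_norm (\<lambda>z. g z - ?p z * h z) \<le> B * H2_norm (\<lambda>z. q z - ?p z)"
  proof (rule H2_domination[OF _ d])
    show "(\<lambda>z. g z - ?p z * h z) \<in> hol_disc"
      by (intro hol_disc_diff H2_hol_disc[OF g] Hinf_hol_disc Hinf_mult poly_disc_Hinf hD)
    fix z assume z: "z \<in> disc"
    have "g z - ?p z * h z = h z * (q z - ?p z)"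
      using hD(2)[OF z] by (simp add: q_def field_simps)
    moreover have "norm (h z) \<le> B" using sup_norm_ge[OF hD(1) z] by (simp add: B_def)
    ultimately show "norm (g z - ?p z * h z) \<le> B * norm (q z - ?p z)"
      by (simp add: norm_mult mult_right_mono)
  qed (use B in simp)
  also have "\<dots> < e" using N B by (simp add: field_simps)
  finally show "\<exists>N c. H2_norm (\<lambda>z. g z - poly_disc N c z * h z) < e" by blast
qed

section \<open>Uniqueness of the factorization\<close>

text \<open>Multiplication by \<open>K\<close> preserves the Hardy norm, so if \<open>p K\<close> is near \<open>1\<close> then \<open>p\<close> has norm near \<open>1\<close> and thus
\<open>\<bar>p(0)\<bar>\<close> is at most about \<open>1\<close>. As \<open>p(0) K(0)\<close> is near \<open>1\<close>, this forces \<open>\<bar>K(0)\<bar> \<ge> 1\<close>. The constant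
coefficient then exhausts the norm of \<open>K\<close>, which is \<open>1\<close>.\<close>

lemma unimodular_cyclic_imp_const:
  assumes K: "K \<in> Hinf" "radially_unimodular K"
    and cyc: "\<And>e. e > 0 \<Longrightarrow> \<exists>N c. H2_norm (\<lambda>z. const_disc 1 z - poly_disc N c z * K z) < e"
  obtains c where "norm c = 1" "\<And>z. z \<in> disc \<Longrightarrow> K z = c"
proof -
  have le1: "norm (K 0) \<le> 1"
    using norm_coef_le_H2_norm[OF Hinf_H2[OF K(1)], of 0] H2_norm_radially_unimodular[OF K] by simp
  have *: "1 - e \<le> (1 + e) * norm (K 0)" if e: "e > 0" for e
  proof -
    obtain N c where Nc: "H2_norm (\<lambda>z. const_disc 1 z - poly_disc N c z * K z) < e"
      using cyc[OF e] by blast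
    let ?P = "poly_disc N c"
    define d where "d = (\<lambda>z. const_disc 1 z - ?P z * K z)"
    have PK: "(\<lambda>z. ?P z * K z) \<in> H2" by (intro Hinf_H2 Hinf_mult poly_disc_Hinf K)
    have d: "d \<in> H2" unfolding d_def by (rule H2_diff[OF Hinf_H2[OF const_disc_Hinf] PK])
    have "(\<lambda>z. - 1 * d z) \<in> hol_disc"
      using H2_hol_disc[OF d] by (auto simp: hol_disc_def intro!: holomorphic_intros)
    note md = H2_domination[OF this d, of 1, simplified]
    have "H2_norm ?P = H2_norm (\<lambda>z. ?P z * K z)"
      using H2_norm_mult_radially_unimodular[OF K poly_disc_Hinf[of N c]] by (simp add: mult.commute)
    also have "\<dots> \<le> H2_norm (const_disc 1) + H2_norm (\<lambda>z. - d z)"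
      by (rule H2_norm_triangle[OF Hinf_H2[OF const_disc_Hinf] md(1) H2_hol_disc[OF PK]])
        (simp add: d_def)
    also have "\<dots> \<le> 1 + e"
      using md(2) Nc by (simp add: H2_norm_const_disc d_def)
    finally have P: "norm (?P 0) \<le> 1 + e"
      using norm_coef_le_H2_norm[OF Hinf_H2[OF poly_disc_Hinf[of N c]], of 0] by simp
    have "norm (1 - ?P 0 * K 0) < e"
      using norm_coef_le_H2_norm[OF d, of 0] Nc by (simp add: d_def const_disc_def)
    then have "1 - e \<le> norm (?P 0) * norm (K 0)"
      using norm_triangle_ineq2[of 1 "1 - ?P 0 * K 0"] by (simp add: norm_mult)
    also have "\<dots> \<le> (1 + e) * norm (K 0)" using P by (simp add: mult_right_mono)
    finally show ?thesis .
  qed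
  have "1 \<le> norm (K 0) + e" if "e > 0" for e
  proof -
    have "1 - e / 2 \<le> (1 + e / 2) * norm (K 0)" using \<open>e > 0\<close> by (intro *) simp
    moreover have "e / 2 * norm (K 0) \<le> e / 2"
      using mult_left_mono[OF le1, of "e / 2"] \<open>e > 0\<close> by simp
    ultimately show ?thesis by (simp add: algebra_simps)
  qed
  then have eq1: "norm (K 0) = 1"
    using le1 by (meson antisym field_le_epsilon)
  have "(H2_norm (\<lambda>z. K z - const_disc (K 0) z))\<^sup>2 = 0"
    using H2_norm_diff_const[OF Hinf_H2[OF K(1)]] H2_norm_radially_unimodular[OF K] eq1
    by simp
  then have "K z = K 0" if "z \<in> disc" for z
    using H2_norm_eq_0[OF H2_diff[OF Hinf_H2[OF K(1)] Hinf_H2[OF const_disc_Hinf]] _ that]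
    that by (simp add: const_disc_def)
  with eq1 show ?thesis by (rule that)
qed

lemma inner_ratio_unimodular:
  assumes u: "u \<in> inner_funs" and v: "v \<in> inner_funs"
    and eq: "\<And>z. z \<in> disc \<Longrightarrow> u z = v z * K z"
  shows "radially_unimodular K"
  using inner_funs_radially_unimodular[OF u] inner_funs_radially_unimodular[OF v]
  unfolding radially_unimodular_def
proof eventually_elim
  case (elim t)
  have lim: "((\<lambda>r. norm (u (of_real r * cis t)) / norm (v (of_real r * cis t))) \<longlongrightarrow> 1) (at_left 1)"
    using tendsto_divide[OF elim] by simp
  have "\<forall>\<^sub>F r in at_left 1. norm (v (of_real r * cis t)) > 0"
    using order_tendstoD(1)[OF elim(2), of 0] by simp
  with eventually_radius_in_disc[of t]
  have "\<forall>\<^sub>F r in at_left 1. norm (u (of_real r * cis t)) / norm (v (of_real r * cis t))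
      = norm (K (of_real r * cis t))"
    by eventually_elim (simp add: eq norm_mult)
  then show ?case by (rule Lim_transform_eventually[OF lim])
qed

lemma mul0_coef: "mul0 f = (LEAST k. coef f k \<noteq> 0)"
  by (simp add: mul0_def coef_def)

lemma normalized_inner_coef:
  "normalized_inner u \<longleftrightarrow> u \<in> inner_funs \<and> (\<exists>c::real. c > 0 \<and> coef u (mul0 u) = of_real c)"
proof -
  have "(\<exists>c::real. c > 0 \<and> (deriv ^^ n) u 0 = of_real c) \<longleftrightarrow> (\<exists>c::real. c > 0 \<and> coef u n = of_real c)"
    (is "?L \<longleftrightarrow> ?R") for n
  proof
    assume ?L
    then obtain c :: real where "c > 0" "(deriv ^^ n) u 0 = of_real c" by blast
    then show ?R by (intro exI[of _ "c / fact n"]) (simp add: coef_def)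
  next
    assume ?R
    then obtain c :: real where "c > 0" "coef u n = of_real c" by blast
    then show ?L by (intro exI[of _ "c * fact n"]) (simp add: coef_def field_simps)
  qed
  then show ?thesis by (simp add: normalized_inner_def)
qed

lemma mul0_nonzero:
  assumes u: "u \<in> hol_disc" "u z \<noteq> 0"
  shows "coef u (mul0 u) \<noteq> 0"
proof -
  have "z \<in> disc" using u by (auto simp: hol_disc_def)
  have "\<exists>k. coef u k \<noteq> 0"
  proof (rule ccontr)
    assume "\<nexists>k. coef u k \<noteq> 0"
    then show False using coef_sums[OF u(1) \<open>z \<in> disc\<close>] u(2) by (simp add: sums_iff)
  qed
  then show ?thesis unfolding mul0_coef by (rule LeastI_ex)
qed

lemma mul0_less: "k < mul0 u \<Longrightarrow> coef u k = 0"
  using not_less_Least[of k "\<lambda>k. coef u k \<noteq> 0"] by (auto simp: mul0_coef)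

lemma mul0_cmult:
  assumes "u \<in> hol_disc" "c \<noteq> 0"
  shows "mul0 (\<lambda>z. c * u z) = mul0 u"
  using assms by (simp add: mul0_coef coef_cmult)

text \<open>In the Leibniz formula for the \<open>n\<close>-th derivative, every term but the last has a vanishing factor.\<close>

lemma coef_mult_of_coef_eq_0:
  assumes "u \<in> hol_disc" "F \<in> hol_disc" "\<And>i. i < n \<Longrightarrow> coef u i = 0"
  shows "coef (\<lambda>z. u z * F z) n = coef u n * F 0"
proof -
  have "(deriv ^^ i) u 0 = 0" if "i < n" for i using assms(3)[OF that] by (simp add: coef_def)
  then have "(\<Sum>i = 0..n. of_nat (n choose i) * (deriv ^^ i) u 0 * (deriv ^^ (n - i)) F 0)
      = (\<Sum>i = 0..n. if i = n then (deriv ^^ n) u 0 * F 0 else 0)"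
    by (intro sum.cong) auto
  also have "\<dots> = (deriv ^^ n) u 0 * F 0" by simp
  finally show ?thesis
    using higher_deriv_mult[of u disc F 0 n] assms(1,2) by (simp add: coef_def hol_disc_def)
qed

lemma mul0_mult:
  assumes u: "u \<in> hol_disc" "u z \<noteq> 0" and F: "F \<in> hol_disc" "F 0 \<noteq> 0"
  shows "mul0 (\<lambda>z. u z * F z) = mul0 u"
  unfolding mul0_coef[of "\<lambda>z. u z * F z"]
proof (rule Least_equality)
  show "coef (\<lambda>z. u z * F z) (mul0 u) \<noteq> 0"
    using mul0_nonzero[OF u] F(2) by (simp add: coef_mult_of_coef_eq_0[OF u(1) F(1) mul0_less])
  show "mul0 u \<le> k" if "coef (\<lambda>z. u z * F z) k \<noteq> 0" for k
  proof (rule ccontr)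
    assume "\<not> mul0 u \<le> k"
    then have "coef u i = 0" if "i \<le> k" for i using that by (auto intro: mul0_less)
    then have "coef (\<lambda>z. u z * F z) k = 0"
      using coef_mult_of_coef_eq_0[OF u(1) F(1), of k] by simp
    with that show False by simp
  qed
qed

lemma inner_nonzero:
  assumes "u \<in> inner_funs"
  obtains z where "u z \<noteq> 0"
proof -
  have "H2_norm u = 1"
    by (rule H2_norm_radially_unimodular[OF inner_funs_Hinf inner_funs_radially_unimodular])
      (use assms in auto)
  moreover have "H2_norm (\<lambda>z. 0) = 0" by (simp add: H2_norm_def circle_mean_def)
  ultimately have "u \<noteq> (\<lambda>z. 0)" by auto
  then show ?thesis using that by auto
qed

lemma inner_cmult:
  assumes "u \<in> inner_funs" "norm c = 1"
  shows "(\<lambda>z. c * u z) \<in> inner_funs"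
proof -
  have "AE t in lebesgue_on {0..2 * pi}.
     \<exists>w. ((\<lambda>r. c * u (of_real r * cis t)) \<longlongrightarrow> w) (at_left 1) \<and> norm w = 1"
  proof (rule AE_mp)
    show "AE t in lebesgue_on {0..2 * pi}.
       \<exists>w. ((\<lambda>r. u (of_real r * cis t)) \<longlongrightarrow> w) (at_left 1) \<and> norm w = 1"
      using assms(1) by (simp add: inner_funs_def)
    show "AE t in lebesgue_on {0..2 * pi}.
       (\<exists>w. ((\<lambda>r. u (of_real r * cis t)) \<longlongrightarrow> w) (at_left 1) \<and> norm w = 1) \<longrightarrow>
       (\<exists>w. ((\<lambda>r. c * u (of_real r * cis t)) \<longlongrightarrow> w) (at_left 1) \<and> norm w = 1)"
      using assms(2) by (intro AE_I2) (metis tendsto_mult_left norm_mult mult_1)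
  qed
  then show ?thesis
    using Hinf_cmult[OF inner_funs_Hinf[OF assms(1)]] by (simp add: inner_funs_def)
qed

text \<open>If \<open>u F = v G\<close>, then \<open>K = G / F\<close> satisfies \<open>u = v K\<close>, so \<open>\<bar>K\<bar>\<close> has radial limits \<open>1\<close>. Since \<open>G\<close> is
cyclic and \<open>1 / F\<close> is bounded, polynomial multiples of \<open>K\<close> approximate \<open>1\<close>. Hence \<open>K\<close> is a
unimodular constant, and the normalization makes it \<open>1\<close>. Invertibility of \<open>F\<close> makes \<open>K\<close>
bounded.\<close>

lemma inner_outer_unique:
  assumes u: "normalized_inner u" and F: "F \<in> Hinf_inv"
    and v: "normalized_inner v" and G: "G \<in> outer_funs"
    and eq: "(\<lambda>z. u z * F z) = (\<lambda>z. v z * G z)"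
  shows "u = v" "F = G"
proof -
  have ui: "u \<in> inner_funs" and vi: "v \<in> inner_funs"
    using u v by (auto simp: normalized_inner_def)
  note FD = Hinf_invD[OF F]
  have GH: "G \<in> Hinf" using G by (simp add: outer_funs_def)
  define K where "K = (\<lambda>z. G z * inverse (F z))"
  have K: "K \<in> Hinf" unfolding K_def by (rule Hinf_mult[OF GH FD(3)])
  have uvK: "u z = v z * K z" if "z \<in> disc" for z
    using fun_cong[OF eq, of z] FD(2)[OF that] by (simp add: K_def field_simps)
  obtain c where c: "norm c = 1" "\<And>z. z \<in> disc \<Longrightarrow> K z = c"
  proof (rule unimodular_cyclic_imp_const[OF K inner_ratio_unimodular[OF ui vi uvK]])
    fix e :: real assume e: "e > 0"
    define B where "B = sup_norm (\<lambda>z. inverse (F z)) + 1"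
    have B: "B > 0" using sup_norm_nonneg[OF FD(3)] by (simp add: B_def)
    obtain N c where Nc: "H2_norm (\<lambda>z. F z - poly_disc N c z * G z) < e / B"
      using G[unfolded outer_funs_iff[OF GH], rule_format, OF Hinf_H2[OF FD(1)], of "e / B"] e B
      by auto
    let ?p = "poly_disc N c"
    have "H2_norm (\<lambda>z. const_disc 1 z - ?p z * K z) \<le> B * H2_norm (\<lambda>z. F z - ?p z * G z)"
    proof (rule H2_domination)
      show "(\<lambda>z. const_disc 1 z - ?p z * K z) \<in> hol_disc"
        by (intro hol_disc_diff Hinf_hol_disc Hinf_mult const_disc_Hinf poly_disc_Hinf K)
      show "(\<lambda>z. F z - ?p z * G z) \<in> H2"
        by (intro Hinf_H2 Hinf_diff Hinf_mult poly_disc_Hinf FD GH)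
      fix z assume z: "z \<in> disc"
      have "const_disc 1 z - ?p z * K z = inverse (F z) * (F z - ?p z * G z)"
        using FD(2)[OF z] z by (simp add: const_disc_def K_def field_simps)
      moreover have "norm (inverse (F z)) \<le> B"
        using sup_norm_ge[OF FD(3) z] by (simp add: B_def)
      ultimately show "norm (const_disc 1 z - ?p z * K z) \<le> B * norm (F z - ?p z * G z)"
        by (metis norm_mult mult_right_mono norm_ge_zero)
    qed (use B in simp)
    also have "\<dots> < e" using Nc B by (simp add: field_simps)
    finally show "\<exists>N c. H2_norm (\<lambda>z. const_disc 1 z - poly_disc N c z * K z) < e" by blast
  qed auto
  have v_hol: "v \<in> hol_disc" by (intro Hinf_hol_disc inner_funs_Hinf vi)
  have u_eq: "u = (\<lambda>z. c * v z)"
  proof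
    show "u z = c * v z" for z
      by (cases "z \<in> disc")
        (use uvK c(2) Hinf_outside[OF inner_funs_Hinf[OF ui]] Hinf_outside[OF inner_funs_Hinf[OF vi]]
          in auto)
  qed
  have c0: "c \<noteq> 0" using c(1) by auto
  obtain a b :: real where ab: "a > 0" "b > 0" "coef u (mul0 u) = of_real a" "coef v (mul0 v) = of_real b"
    using u v by (auto simp: normalized_inner_coef)
  have "of_real a = c * of_real b"
    using ab(3,4) by (simp add: u_eq mul0_cmult[OF v_hol c0] coef_cmult[OF v_hol])
  moreover from this have "a = b"
    using ab(1,2) c(1) by (metis norm_mult norm_of_real abs_of_pos mult_1)
  ultimately have "c = 1" using ab by simp
  then show "u = v" using u_eq by simp
  have "F z = G z" for z
  proof (cases "z \<in> disc")
    case True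
    then show ?thesis using c(2)[OF True] \<open>c = 1\<close> FD(2)[OF True] by (simp add: K_def field_simps)
  next
    case False
    then show ?thesis using Hinf_outside[OF FD(1) False] Hinf_outside[OF GH False] by simp
  qed
  then show "F = G" by auto
qed

text \<open>Given \<open>f = u h\<close>, move a unimodular constant from \<open>h\<close> to \<open>u\<close> to normalize \<open>u\<close>; by uniqueness the
result is the pair selected by \<open>inn_out_pair\<close>. Thus on \<open>Istar\<close> the outer factor is always
invertible.\<close>

lemma Istar_factorization:
  assumes "f \<in> Istar"
  shows "normalized_inner (Q_inn f)" "Q_out f \<in> Hinf_inv" "f = (\<lambda>z. Q_inn f z * Q_out f z)"
    "mul0 (Q_inn f) = mul0 f"
proof -
  obtain u h where uh: "u \<in> inner_funs" "h \<in> Hinf_inv" "f = (\<lambda>z. u z * h z)"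
    using assms by (auto simp: Istar_def)
  have u_hol: "u \<in> hol_disc" by (intro Hinf_hol_disc inner_funs_Hinf uh)
  define a where "a = coef u (mul0 u)"
  have a: "a \<noteq> 0" unfolding a_def using mul0_nonzero[OF u_hol] inner_nonzero[OF uh(1)] by blast
  define c where "c = of_real (norm a) / a"
  have c: "norm c = 1" "c \<noteq> 0" using a by (auto simp: c_def norm_divide)
  define v where "v = (\<lambda>z. c * u z)"
  define F where "F = (\<lambda>z. inverse c * h z)"
  have v: "normalized_inner v"
    unfolding normalized_inner_coef
  proof
    show "v \<in> inner_funs" unfolding v_def by (rule inner_cmult[OF uh(1) c(1)])
    have "coef v (mul0 v) = of_real (norm a)"
      unfolding v_def mul0_cmult[OF u_hol c(2)] coef_cmult[OF u_hol] a_def[symmetric]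
      using a by (simp add: c_def)
    then show "\<exists>c::real. c > 0 \<and> coef v (mul0 v) = of_real c" using a by auto
  qed
  have F: "F \<in> Hinf_inv" unfolding F_def using c(2) by (intro Hinf_inv_cmult uh) auto
  have f: "f = (\<lambda>z. v z * F z)" using c(2) by (simp add: v_def F_def uh(3) fun_eq_iff)
  have "inn_out_pair f = (v, F)"
    unfolding inn_out_pair_def
  proof (rule the_equality)
    show "case (v, F) of (u, F) \<Rightarrow> normalized_inner u \<and> F \<in> outer_funs \<and> f = (\<lambda>z. u z * F z)"
      using v Hinf_inv_outer[OF F] f by simp
    show "p = (v, F)"
      if "case p of (u, F) \<Rightarrow> normalized_inner u \<and> F \<in> outer_funs \<and> f = (\<lambda>z. u z * F z)" for p
    proof -
      obtain w G where p: "p = (w, G)" by (cases p)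
      then have w: "normalized_inner w" and G: "G \<in> outer_funs"
        and eq: "(\<lambda>z. v z * F z) = (\<lambda>z. w z * G z)"
        using that f by auto
      show ?thesis using inner_outer_unique[OF v F w G eq] by (simp add: p)
    qed
  qed
  then have Q: "Q_inn f = v" "Q_out f = F" by (auto simp: Q_inn_def Q_out_def)
  have vi: "v \<in> inner_funs" using v by (simp add: normalized_inner_def)
  obtain z where "v z \<noteq> 0" using inner_nonzero[OF vi] .
  then have "mul0 f = mul0 v"
    unfolding f
    by (rule mul0_mult[OF Hinf_hol_disc[OF inner_funs_Hinf[OF vi]] _
          Hinf_hol_disc[OF Hinf_invD(1)[OF F]] Hinf_invD(2)[OF F]]) simp
  then show "normalized_inner (Q_inn f)" "Q_out f \<in> Hinf_inv" "f = (\<lambda>z. Q_inn f z * Q_out f z)"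
    "mul0 (Q_inn f) = mul0 f"
    using v F f Q by simp_all
qed

section \<open>The factors depend continuously on the product\<close>

lemma H2_norm_le_radial_bound:
  assumes f: "f \<in> Hinf" and M: "0 \<le> M"
    and bound: "AE t in lebesgue_on {0..2 * pi}. \<exists>h. (h \<longlongrightarrow> M) (at_left 1) \<and>
      (\<forall>\<^sub>F r in at_left 1. norm (f (of_real r * cis t)) \<le> h r)"
  shows "H2_norm f \<le> M"
proof -
  have "H2_norm f \<le> H2_norm (const_disc (of_real M))"
  proof (rule H2_norm_le_if_radially_le[OF f const_disc_Hinf])
    show "AE t in lebesgue_on {0..2 * pi}. \<forall>e>0. \<forall>\<^sub>F r in at_left 1.
      (norm (f (of_real r * cis t)))\<^sup>2 \<le> (norm (const_disc (of_real M) (of_real r * cis t)))\<^sup>2 + e"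
      using bound
    proof eventually_elim
      case (elim t)
      then obtain h where h: "(h \<longlongrightarrow> M) (at_left 1)"
        "\<forall>\<^sub>F r in at_left 1. norm (f (of_real r * cis t)) \<le> h r" by blast
      show ?case
      proof (intro allI impI)
        fix e :: real assume e: "e > 0"
        have "\<forall>\<^sub>F r in at_left 1. (h r)\<^sup>2 < M\<^sup>2 + e"
          using order_tendstoD(2)[OF tendsto_power[OF h(1), of 2], of "M\<^sup>2 + e"] e by simp
        with h(2) eventually_radius_in_disc[of t]
        show "\<forall>\<^sub>F r in at_left 1. (norm (f (of_real r * cis t)))\<^sup>2
            \<le> (norm (const_disc (of_real M) (of_real r * cis t)))\<^sup>2 + e"
        proof eventually_elim
          case (elim r)
          have "(norm (f (of_real r * cis t)))\<^sup>2 \<le> (h r)\<^sup>2"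
            by (rule power_mono[OF elim(1)]) simp
          then show ?case using elim(2,3) by (simp add: const_disc_def)
        qed
      qed
    qed
  qed
  then show ?thesis using M by (simp add: H2_norm_const_disc)
qed

lemma H2_norm_le_uniform_bound:
  assumes f: "f \<in> Hinf" and "\<And>z. z \<in> disc \<Longrightarrow> norm (f z) \<le> M"
  shows "H2_norm f \<le> M"
proof -
  have "0 \<le> M" using order_trans[OF norm_ge_zero assms(2)[of 0]] by simp
  then have "H2_norm f \<le> M * H2_norm (const_disc 1)"
    by (intro H2_domination[OF Hinf_hol_disc[OF f] Hinf_H2[OF const_disc_Hinf]])
      (use assms(2) in \<open>auto simp: const_disc_def\<close>)
  then show ?thesis by (simp add: H2_norm_const_disc)
qed

text \<open>The quotient \<open>K\<close> of the outer factors of two nearby functions is nearly constant. On the disc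
\<open>\<bar>\<bar>v\<bar> \<bar>K\<bar> - \<bar>u\<bar>\<bar> \<le> \<eta>\<close>, and \<open>\<bar>u\<bar>\<close> and \<open>\<bar>v\<bar>\<close> tend to \<open>1\<close> radially, so \<open>K\<close> and \<open>1 / K\<close> have Hardy norms at
most \<open>1 + \<eta>\<close> and \<open>1 / (1 - \<eta>)\<close>. The second bound gives \<open>\<bar>K(0)\<bar> \<ge> 1 - \<eta>\<close>, and what remains of \<open>K\<close>
besides its constant coefficient has squared norm at most \<open>(1 + \<eta>)\<^sup>2 - (1 - \<eta>)\<^sup>2 = 4 \<eta>\<close>.\<close>

lemma outer_ratio_estimate:
  assumes u: "u \<in> inner_funs" and v: "v \<in> inner_funs"
    and K: "K \<in> Hinf" "(\<lambda>z. inverse (K z)) \<in> Hinf" "\<And>z. z \<in> disc \<Longrightarrow> K z \<noteq> 0"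
    and \<eta>: "0 \<le> \<eta>" "\<eta> < 1"
    and close: "\<And>z. z \<in> disc \<Longrightarrow> norm (v z * K z - u z) \<le> \<eta>"
  shows "1 - \<eta> \<le> norm (K 0)" "norm (K 0) \<le> 1 + \<eta>"
    and "H2_norm (\<lambda>z. K z - const_disc (K 0) z) \<le> 2 * sqrt \<eta>"
proof -
  have up: "norm (v z) * norm (K z) \<le> norm (u z) + \<eta>"
    and low: "norm (u z) - \<eta> \<le> norm (v z) * norm (K z)" if "z \<in> disc" for z
    using norm_triangle_ineq2[of "v z * K z" "u z"] norm_triangle_ineq2[of "u z" "v z * K z"]
      close[OF that] by (auto simp: norm_mult norm_minus_commute)
  note radial = inner_funs_radially_unimodular[OF u, unfolded radially_unimodular_def]
    inner_funs_radially_unimodular[OF v, unfolded radially_unimodular_def]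
  have "H2_norm K \<le> 1 + \<eta>"
  proof (rule H2_norm_le_radial_bound[OF K(1)])
    show "AE t in lebesgue_on {0..2 * pi}. \<exists>h. (h \<longlongrightarrow> 1 + \<eta>) (at_left 1) \<and>
        (\<forall>\<^sub>F r in at_left 1. norm (K (of_real r * cis t)) \<le> h r)"
      using radial
    proof eventually_elim
      case (elim t)
      define h where "h r = (norm (u (of_real r * cis t)) + \<eta>) / norm (v (of_real r * cis t))" for r
      have "(h \<longlongrightarrow> (1 + \<eta>) / 1) (at_left 1)"
        unfolding h_def by (intro tendsto_intros elim) simp
      moreover have "\<forall>\<^sub>F r in at_left 1. norm (K (of_real r * cis t)) \<le> h r"
        using order_tendstoD(1)[OF elim(2) zero_less_one] eventually_radius_in_disc[of t]
        by eventually_elim (use up in \<open>simp add: h_def field_simps\<close>)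
      ultimately show ?case by auto
    qed
  qed (use \<eta> in simp)
  moreover have "H2_norm (\<lambda>z. inverse (K z)) \<le> 1 / (1 - \<eta>)"
  proof (rule H2_norm_le_radial_bound[OF K(2)])
    show "AE t in lebesgue_on {0..2 * pi}. \<exists>h. (h \<longlongrightarrow> 1 / (1 - \<eta>)) (at_left 1) \<and>
        (\<forall>\<^sub>F r in at_left 1. norm (inverse (K (of_real r * cis t))) \<le> h r)"
      using radial
    proof eventually_elim
      case (elim t)
      define h where "h r = norm (v (of_real r * cis t)) / (norm (u (of_real r * cis t)) - \<eta>)" for r
      have "(h \<longlongrightarrow> 1 / (1 - \<eta>)) (at_left 1)"
        unfolding h_def by (intro tendsto_intros elim) (use \<eta> in simp)
      moreover have "\<forall>\<^sub>F r in at_left 1. norm (inverse (K (of_real r * cis t))) \<le> h r"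
        using order_tendstoD(1)[OF elim(1) \<eta>(2)] eventually_radius_in_disc[of t]
      proof eventually_elim
        case (elim r)
        then show ?case using low[OF elim(2)] K(3)[OF elim(2)]
          by (simp add: h_def norm_inverse norm_divide field_simps)
      qed
      ultimately show ?case by auto
    qed
  qed (use \<eta> in simp)
  ultimately have K_norm: "H2_norm K \<le> 1 + \<eta>" and "norm (inverse (K 0)) \<le> 1 / (1 - \<eta>)"
    using norm_coef_le_H2_norm[OF Hinf_H2[OF K(2)], of 0] by auto
  then show low0: "1 - \<eta> \<le> norm (K 0)"
    using K(3)[of 0] \<eta> by (simp add: norm_inverse norm_divide field_simps)
  show "norm (K 0) \<le> 1 + \<eta>"
    using norm_coef_le_H2_norm[OF Hinf_H2[OF K(1)], of 0] K_norm by simp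
  have "(H2_norm (\<lambda>z. K z - const_disc (K 0) z))\<^sup>2 = (H2_norm K)\<^sup>2 - (norm (K 0))\<^sup>2"
    by (rule H2_norm_diff_const[OF Hinf_H2[OF K(1)]])
  also have "\<dots> \<le> (1 + \<eta>)\<^sup>2 - (1 - \<eta>)\<^sup>2"
    using K_norm H2_norm_nonneg[OF Hinf_H2[OF K(1)]] low0 \<eta>
    by (intro diff_mono power_mono) auto
  also have "\<dots> = (2 * sqrt \<eta>)\<^sup>2"
    using \<eta> by (simp add: power_mult_distrib) (simp add: power2_eq_square algebra_simps)
  finally show "H2_norm (\<lambda>z. K z - const_disc (K 0) z) \<le> 2 * sqrt \<eta>"
    by (rule power2_le_imp_le) (use \<eta> in simp)
qed

text \<open>Both \<open>b \<beta>\<close> and \<open>\<bar>b\<bar> \<beta>\<close> lie within \<open>\<tau>\<close> of the positive number \<open>\<alpha>\<close>, so \<open>b\<close> is close to its own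
modulus, which is close to \<open>1\<close>. The size conditions serve to bound \<open>\<beta>\<close> below.\<close>

lemma phase_estimate:
  fixes b :: complex and \<alpha> \<beta> \<eta> \<tau> :: real
  assumes pos: "\<alpha> > 0" "\<beta> > 0" and b: "\<bar>norm b - 1\<bar> \<le> \<eta>" and \<eta>: "\<eta> \<le> 1"
    and close: "norm (b * of_real \<beta> - of_real \<alpha>) \<le> \<tau>" and \<tau>: "\<tau> \<le> \<alpha> / 2"
  shows "norm (b - 1) \<le> 8 * \<tau> / \<alpha> + \<eta>"
proof -
  have mod: "\<bar>norm b * \<beta> - \<alpha>\<bar> \<le> \<tau>"
    using norm_triangle_ineq3[of "b * of_real \<beta>" "of_real \<alpha>"] close pos by (simp add: norm_mult)
  have "\<alpha> / 2 \<le> norm b * \<beta>" using mod \<tau> by linarith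
  also have "\<dots> \<le> 2 * \<beta>" using b \<eta> pos by (intro mult_right_mono) auto
  finally have \<beta>: "\<alpha> / 4 \<le> \<beta>" by simp
  have "norm (b - of_real (norm b)) * \<beta> = norm (b * of_real \<beta> - of_real (norm b * \<beta>))"
    using pos by (simp add: norm_mult flip: left_diff_distrib)
  also have "\<dots> \<le> norm (b * of_real \<beta> - of_real \<alpha>) + norm (complex_of_real \<alpha> - of_real (norm b * \<beta>))"
    using norm_triangle_ineq[of "b * of_real \<beta> - of_real \<alpha>" "of_real \<alpha> - of_real (norm b * \<beta>)"]
    by simp
  also have "norm (complex_of_real \<alpha> - of_real (norm b * \<beta>)) \<le> \<tau>"
    unfolding of_real_diff[symmetric] norm_of_real using mod by (simp add: abs_minus_commute)
  finally have "norm (b - of_real (norm b)) * \<beta> \<le> 2 * \<tau>" using close by simp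
  moreover have "norm (b - of_real (norm b)) * (\<alpha> / 4) \<le> norm (b - of_real (norm b)) * \<beta>"
    by (rule mult_left_mono[OF \<beta>]) simp
  ultimately have "norm (b - of_real (norm b)) \<le> 8 * \<tau> / \<alpha>"
    using pos by (simp add: field_simps)
  moreover have "norm (of_real (norm b) - (1::complex)) \<le> \<eta>"
    using b by (metis norm_of_real of_real_1 of_real_diff)
  ultimately show ?thesis
    using norm_triangle_ineq[of "b - of_real (norm b)" "of_real (norm b) - 1"] by simp
qed

text \<open>A local Hoelder estimate of exponent \<open>1/2\<close> for both factors. With \<open>K = G / F\<close> and \<open>b = K(0)\<close>,
the near constancy of \<open>K\<close> gives \<open>b v \<approx> u\<close>. The leading coefficients of the normalized functions
\<open>u\<close> and \<open>v\<close> are positive and, by the assumption on the multiplicities, sit in the same degree;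
comparing them gives \<open>b \<approx> 1\<close>. Then \<open>v \<approx> u\<close>, and \<open>G = K F \<approx> F\<close>.\<close>

lemma factor_estimate:
  assumes u: "normalized_inner u" and v: "normalized_inner v" and mul: "mul0 v = mul0 u"
    and F: "F \<in> Hinf_inv" and G: "G \<in> Hinf_inv"
    and \<alpha>: "coef u (mul0 u) = of_real \<alpha>" "\<alpha> > 0"
    and \<delta>: "\<delta> > 0" "\<And>z. z \<in> disc \<Longrightarrow> \<delta> \<le> norm (F z)"
    and \<eta>: "0 \<le> \<eta>" "\<eta> < 1" "6 * sqrt \<eta> \<le> \<alpha>"
    and close: "\<And>z. z \<in> disc \<Longrightarrow> norm (v z * G z - u z * F z) \<le> \<eta> * \<delta>"
  shows "H2_norm (\<lambda>z. v z - u z) \<le> (4 + 24 / \<alpha>) * sqrt \<eta>"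
    and "H2_norm (\<lambda>z. G z - F z) \<le> sup_norm F * ((4 + 24 / \<alpha>) * sqrt \<eta>)"
proof -
  have ui: "u \<in> inner_funs" and vi: "v \<in> inner_funs"
    using u v by (auto simp: normalized_inner_def)
  note uH = inner_funs_Hinf[OF ui] and vH = inner_funs_Hinf[OF vi]
  note FD = Hinf_invD[OF F] and GD = Hinf_invD[OF G]
  define K where "K = (\<lambda>z. G z * inverse (F z))"
  have K: "K \<in> Hinf" unfolding K_def by (rule Hinf_mult[OF GD(1) FD(3)])
  have K': "(\<lambda>z. inverse (K z)) \<in> Hinf"
    using Hinf_mult[OF FD(1) GD(3)] by (simp add: K_def mult.commute)
  have K0: "K z \<noteq> 0" if "z \<in> disc" for z using FD(2)[OF that] GD(2)[OF that] by (simp add: K_def)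
  have vKu: "norm (v z * K z - u z) \<le> \<eta>" if z: "z \<in> disc" for z
  proof -
    have "(v z * K z - u z) * F z = v z * G z - u z * F z"
      using FD(2)[OF z] by (simp add: K_def field_simps)
    then have "norm (v z * K z - u z) * norm (F z) \<le> \<eta> * \<delta>"
      using close[OF z] by (simp flip: norm_mult)
    also have "\<dots> \<le> \<eta> * norm (F z)" using \<delta>(2)[OF z] \<eta>(1) by (rule mult_left_mono)
    finally show ?thesis using FD(2)[OF z] by simp
  qed
  define b where "b = K 0"
  note est = outer_ratio_estimate[OF ui vi K K' K0 \<eta>(1,2) vKu, folded b_def]
  have sq: "\<eta> \<le> sqrt \<eta>"
    using \<eta> by (intro real_le_rsqrt) (simp add: power2_eq_square mult_left_le)
  define D where "D = (\<lambda>z. K z - const_disc b z)"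
  have D: "D \<in> Hinf" "H2_norm D \<le> 2 * sqrt \<eta>"
    using est(3) Hinf_diff[OF K const_disc_Hinf] by (auto simp: D_def)
  have bv: "(\<lambda>z. b * v z - u z) \<in> Hinf" by (intro Hinf_diff Hinf_cmult uH vH)
  \<comment> \<open>Split off the part of \<open>K\<close> that is not constant: \<open>b v - u = (v K - u) - v (K - b)\<close>.\<close>
  have "H2_norm (\<lambda>z. b * v z - u z)
      \<le> H2_norm (\<lambda>z. v z * K z - u z) + H2_norm (\<lambda>z. v z * (- 1 * D z))"
  proof (rule H2_norm_triangle)
    show "(\<lambda>z. v z * K z - u z) \<in> H2" by (intro Hinf_H2 Hinf_diff Hinf_mult uH vH K)
    show "(\<lambda>z. v z * (- 1 * D z)) \<in> H2" by (intro Hinf_H2 Hinf_mult Hinf_cmult vH D)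
  qed (auto simp: Hinf_hol_disc[OF bv] D_def const_disc_def algebra_simps)
  also have "H2_norm (\<lambda>z. v z * (- 1 * D z)) = H2_norm (\<lambda>z. - 1 * D z)"
    by (rule H2_norm_mult_radially_unimodular[OF vH inner_funs_radially_unimodular[OF vi]
          Hinf_cmult[OF D(1)]])
  also have "\<dots> \<le> 1 * H2_norm D"
    by (rule H2_domination[OF Hinf_hol_disc[OF Hinf_cmult[OF D(1)]] Hinf_H2[OF D(1)]]) auto
  also have "H2_norm (\<lambda>z. v z * K z - u z) \<le> \<eta>"
    by (rule H2_norm_le_uniform_bound[OF Hinf_diff[OF Hinf_mult[OF vH K] uH] vKu])
  finally have inner: "H2_norm (\<lambda>z. b * v z - u z) \<le> 3 * sqrt \<eta>" using D(2) sq by linarith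
  obtain \<beta> where \<beta>: "\<beta> > 0" "coef v (mul0 u) = of_real \<beta>"
    using v mul by (auto simp: normalized_inner_coef)
  have "coef (\<lambda>z. b * v z - u z) (mul0 u) = b * of_real \<beta> - of_real \<alpha>"
    using \<beta>(2) \<alpha>(1)
    by (simp add: coef_diff[OF Hinf_hol_disc[OF Hinf_cmult[OF vH]] Hinf_hol_disc[OF uH]]
        coef_cmult[OF Hinf_hol_disc[OF vH]])
  then have "norm (b * of_real \<beta> - of_real \<alpha>) \<le> 3 * sqrt \<eta>"
    using norm_coef_le_H2_norm[OF Hinf_H2[OF bv], of "mul0 u"] inner by simp
  then have "norm (b - 1) \<le> 8 * (3 * sqrt \<eta>) / \<alpha> + \<eta>"
    using est(1,2) \<eta> by (intro phase_estimate[OF \<alpha>(2) \<beta>(1)]) auto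
  also have "\<dots> \<le> (1 + 24 / \<alpha>) * sqrt \<eta>" using sq by (simp add: algebra_simps)
  finally have phase: "norm (b - 1) \<le> (1 + 24 / \<alpha>) * sqrt \<eta>" .
  have "H2_norm (\<lambda>z. v z - u z)
      \<le> H2_norm (\<lambda>z. b * v z - u z) + H2_norm (\<lambda>z. (1 - b) * v z)"
    by (rule H2_norm_triangle[OF Hinf_H2[OF bv] Hinf_H2[OF Hinf_cmult[OF vH]]
          Hinf_hol_disc[OF Hinf_diff[OF vH uH]]]) (simp add: algebra_simps)
  also have "H2_norm (\<lambda>z. (1 - b) * v z) \<le> norm (1 - b) * H2_norm v"
    by (rule H2_domination[OF Hinf_hol_disc[OF Hinf_cmult[OF vH]] Hinf_H2[OF vH]])
      (auto simp: norm_mult)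
  also have "\<dots> = norm (b - 1)"
    by (simp add: H2_norm_radially_unimodular[OF vH inner_funs_radially_unimodular[OF vi]]
        norm_minus_commute)
  finally show "H2_norm (\<lambda>z. v z - u z) \<le> (4 + 24 / \<alpha>) * sqrt \<eta>"
    using inner phase by (simp add: algebra_simps)
  \<comment> \<open>\<open>E = K - 1\<close> on the disc, so that \<open>G - F = F E\<close>.\<close>
  define E where "E = (\<lambda>z. D z + const_disc (b - 1) z)"
  have cH: "const_disc (b - 1) \<in> Hinf" by (rule const_disc_Hinf)
  have "E = (\<lambda>z. D z - (- 1) * const_disc (b - 1) z)" by (simp add: E_def)
  then have E: "E \<in> Hinf" using Hinf_diff[OF D(1) Hinf_cmult[OF cH]] by metis
  have "H2_norm E \<le> H2_norm D + H2_norm (const_disc (b - 1))"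
    by (rule H2_norm_triangle[OF Hinf_H2[OF D(1)] Hinf_H2[OF cH] Hinf_hol_disc[OF E]])
      (simp add: E_def)
  also have "\<dots> \<le> (4 + 24 / \<alpha>) * sqrt \<eta>"
    unfolding H2_norm_const_disc using D(2) phase real_sqrt_ge_zero[OF \<eta>(1)]
    by (simp only: distrib_right)
  finally have E_le: "H2_norm E \<le> (4 + 24 / \<alpha>) * sqrt \<eta>" .
  have "H2_norm (\<lambda>z. G z - F z) \<le> sup_norm F * H2_norm E"
  proof (rule H2_domination[OF Hinf_hol_disc[OF Hinf_diff[OF GD(1) FD(1)]] Hinf_H2[OF E]])
    fix z assume z: "z \<in> disc"
    have "G z - F z = F z * E z"
      using FD(2)[OF z] z by (simp add: E_def D_def K_def const_disc_def field_simps)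
    then show "norm (G z - F z) \<le> sup_norm F * norm (E z)"
      using sup_norm_ge[OF FD(1) z] by (simp add: norm_mult mult_right_mono)
  qed (rule sup_norm_nonneg[OF FD(1)])
  also have "\<dots> \<le> sup_norm F * ((4 + 24 / \<alpha>) * sqrt \<eta>)"
    by (rule mult_left_mono[OF E_le sup_norm_nonneg[OF FD(1)]])
  finally show "H2_norm (\<lambda>z. G z - F z) \<le> sup_norm F * ((4 + 24 / \<alpha>) * sqrt \<eta>)" .
qed

lemma Istar_Hinf: "Istar \<subseteq> Hinf"
  using Hinf_mult[OF inner_funs_Hinf Hinf_invD(1)] by (auto simp: Istar_def)

lemma inner_outer_factors_continuous_at:
  assumes f: "f \<in> Istar_n n" and e: "e > 0"
  obtains d where "d > 0"
    "\<And>g. g \<in> Istar_n n \<Longrightarrow> sup_dist f g < d \<Longrightarrow>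
      H2_norm (\<lambda>z. Q_inn g z - Q_inn f z) < e \<and> H2_norm (\<lambda>z. Q_out g z - Q_out f z) < e"
proof -
  have fI: "f \<in> Istar" "mul0 f = n" using f by (auto simp: Istar_n_def)
  note Qf = Istar_factorization[OF fI(1)]
  note FD = Hinf_invD[OF Qf(2)]
  define u F where "u = Q_inn f" and "F = Q_out f"
  obtain \<alpha> where \<alpha>: "\<alpha> > 0" "coef u (mul0 u) = of_real \<alpha>"
    using Qf(1) by (auto simp: u_def normalized_inner_coef)
  \<comment> \<open>The summand \<open>1\<close> makes the bound positive without a case distinction.\<close>
  define S where "S = sup_norm (\<lambda>z. inverse (F z)) + 1"
  have S: "S > 0" using sup_norm_nonneg[OF FD(3)] by (simp add: S_def F_def)
  have F_lower: "1 / S \<le> norm (F z)" if "z \<in> disc" for z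
  proof -
    have "norm (inverse (F z)) \<le> S" using sup_norm_ge[OF FD(3) that] by (simp add: S_def F_def)
    then show ?thesis using S FD(2)[OF that] by (simp add: norm_inverse norm_divide field_simps F_def)
  qed
  let ?C = "4 + 24 / \<alpha>"
  have "\<forall>\<^sub>F \<eta> in at_right (0::real). 0 < \<eta> \<and> \<eta> < 1 \<and> 6 * sqrt \<eta> < \<alpha> \<and> ?C * sqrt \<eta> < e
      \<and> sup_norm F * (?C * sqrt \<eta>) < e"
  proof (intro eventually_conj)
    have lim: "((\<lambda>\<eta>. c * sqrt \<eta>) \<longlongrightarrow> 0) (at_right 0)" for c :: real
      by (auto intro!: tendsto_eq_intros)
    show "\<forall>\<^sub>F \<eta> in at_right (0::real). 0 < \<eta>" by (rule eventually_at_right_less)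
    show "\<forall>\<^sub>F \<eta> in at_right (0::real). \<eta> < 1"
      using eventually_at_right_real[OF zero_less_one] by eventually_elim simp
    show "\<forall>\<^sub>F \<eta> in at_right 0. 6 * sqrt \<eta> < \<alpha>" by (rule order_tendstoD(2)[OF lim \<alpha>(1)])
    show "\<forall>\<^sub>F \<eta> in at_right 0. ?C * sqrt \<eta> < e" by (rule order_tendstoD(2)[OF lim e])
    show "\<forall>\<^sub>F \<eta> in at_right 0. sup_norm F * (?C * sqrt \<eta>) < e"
      using order_tendstoD(2)[OF lim[of "sup_norm F * ?C"] e] by (simp add: mult.assoc)
  qed
  from eventually_happens'[OF trivial_limit_at_right_real this] obtain \<eta> where \<eta>: "0 < \<eta>" "\<eta> < 1" "6 * sqrt \<eta> < \<alpha>" "?C * sqrt \<eta> < e"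
    "sup_norm F * (?C * sqrt \<eta>) < e" by blast
  show ?thesis
  proof (rule that[of "\<eta> * (1 / S)"])
    show "\<eta> * (1 / S) > 0" using \<eta> S by simp
    fix g assume g: "g \<in> Istar_n n" and d: "sup_dist f g < \<eta> * (1 / S)"
    have gI: "g \<in> Istar" "mul0 g = n" using g by (auto simp: Istar_n_def)
    note Qg = Istar_factorization[OF gI(1)]
    have H: "f \<in> Hinf" "g \<in> Hinf" using fI gI Istar_Hinf by auto
    have gf: "norm (g z - f z) \<le> \<eta> * (1 / S)" if "z \<in> disc" for z
      using sup_norm_ge[OF Hinf_diff[OF H] that] d H
      by (simp add: sup_dist_def norm_minus_commute)
    have close: "norm (Q_inn g z * Q_out g z - u z * F z) \<le> \<eta> * (1 / S)" if "z \<in> disc" for z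
      using gf[OF that] fun_cong[OF Qg(3), of z, symmetric] fun_cong[OF Qf(3), of z, symmetric]
      by (simp add: u_def F_def)
    have "mul0 (Q_inn g) = mul0 u" using Qf(4) Qg(4) fI gI by (simp add: u_def)
    from factor_estimate[OF Qf(1)[folded u_def] Qg(1) this Qf(2)[folded F_def] Qg(2) \<alpha>(2,1)
        _ F_lower _ \<eta>(2) _ close] \<eta> S
    show "H2_norm (\<lambda>z. Q_inn g z - Q_inn f z) < e \<and> H2_norm (\<lambda>z. Q_out g z - Q_out f z) < e"
      by (force simp: u_def F_def)
  qed
qed

theorem theorem2p3:
  fixes n :: nat
  shows "continuous_map (sup_top (Istar_n n)) (H2_top inner_funs) Q_inn \<and>
         continuous_map (sup_top (Istar_n n)) (H2_top outer_funs) Q_out"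
proof -
  have IH: "Istar_n n \<subseteq> Hinf" using Istar_Hinf by (auto simp: Istar_n_def)
  have inH: "inner_funs \<subseteq> H2" and outH: "outer_funs \<subseteq> H2"
    by (auto simp: outer_funs_def intro: Hinf_H2 inner_funs_Hinf)
  have X: "Metric_space (Istar_n n) sup_dist"
    by (rule Metric_space.subspace[OF Metric_space_sup_dist IH])
  have Yin: "Metric_space inner_funs H2_dist"
    by (rule Metric_space.subspace[OF Metric_space_H2_dist inH])
  have Yout: "Metric_space outer_funs H2_dist"
    by (rule Metric_space.subspace[OF Metric_space_H2_dist outH])
  have inn: "Q_inn f \<in> inner_funs" and out: "Q_out f \<in> outer_funs" if "f \<in> Istar_n n" for f
    using Istar_factorization(1,2)[of f] that Hinf_inv_outer
    by (auto simp: Istar_n_def normalized_inner_def)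
  have "\<exists>d>0. \<forall>g. g \<in> Istar_n n \<and> sup_dist f g < d \<longrightarrow>
      H2_dist (Q_inn f) (Q_inn g) < e \<and> H2_dist (Q_out f) (Q_out g) < e"
    if f: "f \<in> Istar_n n" and e: "e > 0" for f e
  proof -
    obtain d where d: "d > 0" "\<And>g. g \<in> Istar_n n \<Longrightarrow> sup_dist f g < d \<Longrightarrow>
      H2_norm (\<lambda>z. Q_inn g z - Q_inn f z) < e \<and> H2_norm (\<lambda>z. Q_out g z - Q_out f z) < e"
      using inner_outer_factors_continuous_at[OF f e] by blast
    have "H2_dist (Q_inn f) (Q_inn g) < e \<and> H2_dist (Q_out f) (Q_out g) < e"
      if g: "g \<in> Istar_n n" "sup_dist f g < d" for g
      unfolding Metric_space.commute[OF Metric_space_H2_dist, of _ "Q_inn g"]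
        Metric_space.commute[OF Metric_space_H2_dist, of _ "Q_out g"]
      using d(2)[OF g] inn[OF f] inn[OF g(1)] out[OF f] out[OF g(1)] inH outH
      by (auto simp: H2_dist_def)
    with d(1) show ?thesis by blast
  qed
  then show ?thesis
    unfolding Metric_space.metric_continuous_map[OF X Yin] Metric_space.metric_continuous_map[OF X Yout]
    using inn out by (meson image_subsetI)
qed

end
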